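(* Let $\mathcal{M}_{\mathbb P}$ and $\mathcal{M}_{\mathbb L}$ be the models of partially ordered, respectively linearly ordered, traces over event structures, for an arbitrary choice of a prime event structure $\mathcal{E}_\alpha$ for each channel $\alpha$. Then both $\mathcal{M}_{\mathbb P}$ and $\mathcal{M}_{\mathbb L}$ satisfy the Generalized Kahn Principle: for every non-deterministic functional network $\{(S_j,P_j)\}_{j\in J}$ in the model, with network composition $(S,P)$ and with $(S_j,P_j)$ computing $F_j$, \[ \mu_S(P)=\{\mathrm{lfp}(G_f)\mid f\in \textstyle\prod_{j\in J}F_j\}. \]
   Context: A cpo is a directed-complete poset with least element $\bot$; $K(D)$ denotes the compact elements of a cpo $D$, $K(d)=\{b\in K(D)\mid b\sqsubseteq d\}$, and $[D\to E]$ the continuous maps. Covering relation: $x\prec y$ iff $x\sqsubseteq y$, $x\neq y$, and there is no $z$ with $x\sqsubsetneq z\sqsubsetneq y$. Relative cover: $b\prec c$ relative to $d$ means $b,c\in K(d)$ and $b\prec c$. A prime event structure $\mathcal{E}=(E,\leqslant,\mathrm{Con})$: $(E,\leqslant)$ a countable poset with every $\downarrow e$ finite; $\mathrm{Con}$ a family of finite subsets of $E$ containing all singletons, closed under subsets, and with $A\in\mathrm{Con}\Rightarrow \downarrow A\in\mathrm{Con}$. A configuration is a downward-closed $x\subseteq E$ all of whose finite subsets lie in $\mathrm{Con}$; $|\mathcal{E}|$ is the cpo of configurations ordered by inclusion. A trace over $\mathcal{E}$ is a pair $t=(x_t,\leqslant_t)$ with $x_t\in|\mathcal{E}|$ and $\leqslant_t$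 a partial order on $x_t$ such that each $\{e'\in x_t\mid e'\leqslant_t e\}$ is finite and $(\leqslant\cap x_t^2)\subseteq\leqslant_t$; traces are ordered by $t\sqsubseteq t'$ iff $x_t\subseteq x_{t'}$, $\leqslant_t=\leqslant_{t'}\cap x_t^2$, and $e\leqslant_{t'}e'\in x_t\Rightarrow e\in x_t$. $\mathbb{P}(\mathcal{E})$ is the cpo of traces, $\mathbb{L}(\mathcal{E})$ the sub-cpo of traces with $\leqslant_t$ linear. Channels and sorts: fix a class of channel names; a sort is a set of channels. For each channel $\alpha$ fix a prime event structure $\mathcal{E}_\alpha=(E_\alpha,\leqslant_\alpha,\mathrm{Con}_\alpha)$. For a sort $S$, $\mathcal{E}_S=(E_S,\leqslant_S,\mathrm{Con}_S)$ with $E_S=\{(\alpha,e)\mid\alpha\in S,e\in E_\alpha\}$, $(\alpha,e)\leqslant_S(\beta,e')$ iff $\alpha=\beta$ and $e\leqslant_\alpha e'$, and $A\in\mathrm{Con}_S$ iff for each $\alpha\in S$, $\{e\mid(\alpha,e)\in A\}\in\mathrm{Con}_\alpha$. The model $\mathcal{M}_{\mathbb P}$ has value domains $\mathcal{V}_S=|\mathcal{E}_S|$ (so $\mathcal{V}_S\cong\prod_{\alpha\in S}|\mathcal{E}_\alpha|$), projections $\pi^S_T(x)=x\cap E_T$ for $S\supseteq T$, trace domains $\mathcal{T}_S=\mathbb{P}(\mathcal{E}_S)$, restriction maps $\rho^S_T(t)=(x_t\cap E_T,\leqslant_t\cap E_T^2)$, and evaluation maps $\mu_S(t)=x_t$.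 $\mathcal{M}_{\mathbb L}$ is the same with $\mathcal{T}_S=\mathbb{L}(\mathcal{E}_S)$. Write $\hat\rho^S_T=\mu_T\circ\rho^S_T=\pi^S_T\circ\mu_S$. A process is a pair $(S,P)$ with $S$ a sort and $P\subseteq\mathcal{T}_S$. The network composition of a family $\{(S_j,P_j)\}_{j\in J}$ is $(S,P)$ with $S=\bigcup_jS_j$ and $P=\{t\in\mathcal{T}_S\mid\forall j.\ \rho^S_{S_j}(t)\in P_j\}$. A process $(S,P)$ with $S=I\cup O$ computes a set $F\subseteq[\mathcal{V}_I\to\mathcal{V}_O]$ if for all $t\in\mathcal{T}_S$: $t\in P$ iff there is $f\in F$ with (1) $\hat\rho^S_O(t)=f(\hat\rho^S_I(t))$ and (2) for all $u\prec v$ relative to $t$, $\hat\rho^S_O(v)\sqsubseteq f(\hat\rho^S_I(u))$. A family $\{(S_j,P_j)\}_{j\in J}$ with composition $(S,P)$ is a non-deterministic functional network if each $S_j=I_j\cup O_j$ with $(S_j,P_j)$ computing some $F_j\subseteq[\mathcal{V}_{I_j}\to\mathcal{V}_{O_j}]$, and every $\alpha\in S$ lies in $O_j$ for exactly one $j$. For $f=(f_j)\in\prod_jF_j$, $G_f:\mathcal{V}_S\to\mathcal{V}_S$ is the map whose $\alpha$-component is $\pi^{O_j}_{\{\alpha\}}\circ f_j\circ\pi^S_{I_j}$ for the unique $j$ with $\alpha\in O_j$; $\mathrm{lfp}(G_f)=\bigsqcup_kG_f^k(\bot)$.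
   Formalization: For M_L, E_S of the composite sort S is also required to be a prime event structure, i.e. countable; otherwise the claim fails, e.g. for uncountably many constant processes each emitting one event. The M_P half holds for all sorts. *)

theory Defs
  imports "HOL-Library.Countable_Set" "HOL-Library.FuncSet"
begin

section \<open>Domain theory on explicit carriers\<close>

text \<open>
  The value and trace domains depend on a sort, so a poset is given by a carrier \<open>D\<close>
  and an order \<open>le\<close> that is used on \<open>D\<close> only.
\<close>

definition directed_in :: "'a set \<Rightarrow> ('a \<Rightarrow> 'a \<Rightarrow> bool) \<Rightarrow> 'a set \<Rightarrow> bool" where
  "directed_in D le A \<longleftrightarrow> A \<subseteq> D \<and> A \<noteq> {} \<and> (\<forall>x\<in>A. \<forall>y\<in>A. \<exists>z\<in>A. le x z \<and> le y z)"

definition lub_in :: "'a set \<Rightarrow> ('a \<Rightarrow> 'a \<Rightarrow> bool) \<Rightarrow> 'a set \<Rightarrow> 'a \<Rightarrow> bool" where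
  "lub_in D le A s \<longleftrightarrow> s \<in> D \<and> (\<forall>a\<in>A. le a s) \<and> (\<forall>z\<in>D. (\<forall>a\<in>A. le a z) \<longrightarrow> le s z)"

definition compacts :: "'a set \<Rightarrow> ('a \<Rightarrow> 'a \<Rightarrow> bool) \<Rightarrow> 'a set" where
  "compacts D le = {b \<in> D. \<forall>A s. directed_in D le A \<longrightarrow> lub_in D le A s \<longrightarrow> le b s
                                \<longrightarrow> (\<exists>a\<in>A. le b a)}"

definition compacts_below :: "'a set \<Rightarrow> ('a \<Rightarrow> 'a \<Rightarrow> bool) \<Rightarrow> 'a \<Rightarrow> 'a set" where
  "compacts_below D le d = {b \<in> compacts D le. le b d}"

definition covers :: "'a set \<Rightarrow> ('a \<Rightarrow> 'a \<Rightarrow> bool) \<Rightarrow> 'a \<Rightarrow> 'a \<Rightarrow> bool" where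
  "covers D le x y \<longleftrightarrow> x \<in> D \<and> y \<in> D \<and> le x y \<and> x \<noteq> y \<and>
     \<not> (\<exists>z\<in>D. le x z \<and> x \<noteq> z \<and> le z y \<and> z \<noteq> y)"

definition covers_rel :: "'a set \<Rightarrow> ('a \<Rightarrow> 'a \<Rightarrow> bool) \<Rightarrow> 'a \<Rightarrow> 'a \<Rightarrow> 'a \<Rightarrow> bool" where
  "covers_rel D le d b c \<longleftrightarrow>
     b \<in> compacts_below D le d \<and> c \<in> compacts_below D le d \<and> covers D le b c"

text \<open>
  Elements are not required to be extensional: only their values on \<open>D\<close> are ever used.
  Monotonicity follows from the preservation of lubs of two-element directed sets.
\<close>

definition continuous_maps ::
  "'a set \<Rightarrow> ('a \<Rightarrow> 'a \<Rightarrow> bool) \<Rightarrow> 'b set \<Rightarrow> ('b \<Rightarrow> 'b \<Rightarrow> bool) \<Rightarrow> ('a \<Rightarrow> 'b) set" where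
  "continuous_maps D le D' le' = {f \<in> D \<rightarrow> D'. \<forall>A s.
     directed_in D le A \<longrightarrow> lub_in D le A s \<longrightarrow> lub_in D' le' (f ` A) (f s)}"


section \<open>Prime event structures and traces\<close>

record 'e event_structure =
  events :: "'e set"
  causality :: "'e rel"
  consistent :: "'e set set"

text \<open>
  The clause \<open>{} \<in> consistent \<E>\<close> follows from the others unless there are no events;
  it then ensures that the empty set is a configuration, so that configurations form a cpo.
\<close>

definition prime_event_structure :: "'e event_structure \<Rightarrow> bool" where
  "prime_event_structure \<E> \<longleftrightarrow>
     countable (events \<E>) \<and>
     partial_order_on (events \<E>) (causality \<E>) \<and>
     (\<forall>e \<in> events \<E>. finite {e'. (e', e) \<in> causality \<E>}) \<and>
     (\<forall>A \<in> consistent \<E>. finite A \<and> A \<subseteq> events \<E>) \<and>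
     {} \<in> consistent \<E> \<and>
     (\<forall>e \<in> events \<E>. {e} \<in> consistent \<E>) \<and>
     (\<forall>A \<in> consistent \<E>. \<forall>B. B \<subseteq> A \<longrightarrow> B \<in> consistent \<E>) \<and>
     (\<forall>A \<in> consistent \<E>. {e'. \<exists>e\<in>A. (e', e) \<in> causality \<E>} \<in> consistent \<E>)"

definition configurations :: "'e event_structure \<Rightarrow> 'e set set" where
  "configurations \<E> = {x. x \<subseteq> events \<E> \<and>
     (\<forall>e\<in>x. \<forall>e'. (e', e) \<in> causality \<E> \<longrightarrow> e' \<in> x) \<and>
     (\<forall>A. A \<subseteq> x \<longrightarrow> finite A \<longrightarrow> A \<in> consistent \<E>)}"

type_synonym 'e trace = "'e set \<times> 'e rel"

definition traces :: "'e event_structure \<Rightarrow> 'e trace set" where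
  "traces \<E> = {(x, r). x \<in> configurations \<E> \<and> partial_order_on x r \<and>
     (\<forall>e\<in>x. finite {e' \<in> x. (e', e) \<in> r}) \<and> causality \<E> \<inter> x \<times> x \<subseteq> r}"

definition linear_traces :: "'e event_structure \<Rightarrow> 'e trace set" where
  "linear_traces \<E> = {(x, r) \<in> traces \<E>. linear_order_on x r}"

definition trace_le :: "'e trace \<Rightarrow> 'e trace \<Rightarrow> bool" where
  "trace_le t t' \<longleftrightarrow> fst t \<subseteq> fst t' \<and> snd t = snd t' \<inter> fst t \<times> fst t \<and>
     (\<forall>e e'. (e, e') \<in> snd t' \<longrightarrow> e' \<in> fst t \<longrightarrow> e \<in> fst t)"


section \<open>Sorts, value domains and trace domains\<close>

text \<open>
  The families \<open>\<E>\<close> of event structures indexed by channels share one type of events; the carriers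
  \<open>events (\<E> \<alpha>)\<close> are arbitrary. Consistent sets over an infinite sort must be required to be
  finite, since this does not follow from the finiteness of their components.
\<close>

definition sort_es :: "('c \<Rightarrow> 'e event_structure) \<Rightarrow> 'c set \<Rightarrow> ('c \<times> 'e) event_structure" where
  "sort_es \<E> S = \<lparr>
     events = {(\<alpha>, e). \<alpha> \<in> S \<and> e \<in> events (\<E> \<alpha>)},
     causality = {((\<alpha>, e), (\<beta>, e')). \<alpha> = \<beta> \<and> \<alpha> \<in> S \<and> (e, e') \<in> causality (\<E> \<alpha>)},
     consistent = {A. finite A \<and> A \<subseteq> {(\<alpha>, e). \<alpha> \<in> S \<and> e \<in> events (\<E> \<alpha>)} \<and>
                      (\<forall>\<alpha>\<in>S. {e. (\<alpha>, e) \<in> A} \<in> consistent (\<E> \<alpha>))} \<rparr>"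

definition val_dom :: "('c \<Rightarrow> 'e event_structure) \<Rightarrow> 'c set \<Rightarrow> ('c \<times> 'e) set set" where
  "val_dom \<E> S = configurations (sort_es \<E> S)"

definition proj ::
  "('c \<Rightarrow> 'e event_structure) \<Rightarrow> 'c set \<Rightarrow> ('c \<times> 'e) set \<Rightarrow> ('c \<times> 'e) set" where
  "proj \<E> T x = x \<inter> events (sort_es \<E> T)"

definition restr ::
  "('c \<Rightarrow> 'e event_structure) \<Rightarrow> 'c set \<Rightarrow> ('c \<times> 'e) trace \<Rightarrow> ('c \<times> 'e) trace" where
  "restr \<E> T t = (fst t \<inter> events (sort_es \<E> T),
                  snd t \<inter> events (sort_es \<E> T) \<times> events (sort_es \<E> T))"

definition eval_trace :: "('c \<times> 'e) trace \<Rightarrow> ('c \<times> 'e) set" where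
  "eval_trace t = fst t"

definition restr_val ::
  "('c \<Rightarrow> 'e event_structure) \<Rightarrow> 'c set \<Rightarrow> ('c \<times> 'e) trace \<Rightarrow> ('c \<times> 'e) set" where
  "restr_val \<E> T t = eval_trace (restr \<E> T t)"

text \<open>
  The two models share value domains, projections, restrictions and evaluation maps, and are
  therefore represented by the map sending a sort to its trace domain.
\<close>

definition model_P :: "('c \<Rightarrow> 'e event_structure) \<Rightarrow> 'c set \<Rightarrow> ('c \<times> 'e) trace set" where
  "model_P \<E> S = traces (sort_es \<E> S)"

definition model_L :: "('c \<Rightarrow> 'e event_structure) \<Rightarrow> 'c set \<Rightarrow> ('c \<times> 'e) trace set" where
  "model_L \<E> S = linear_traces (sort_es \<E> S)"


section \<open>Processes and networks\<close>

type_synonym ('c, 'e) process = "'c set \<times> ('c \<times> 'e) trace set"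
type_synonym ('c, 'e) val_map = "('c \<times> 'e) set \<Rightarrow> ('c \<times> 'e) set"

definition is_process :: "('c set \<Rightarrow> ('c \<times> 'e) trace set) \<Rightarrow> ('c, 'e) process \<Rightarrow> bool" where
  "is_process \<T> p \<longleftrightarrow> snd p \<subseteq> \<T> (fst p)"

definition network_composition ::
  "('c \<Rightarrow> 'e event_structure) \<Rightarrow> ('c set \<Rightarrow> ('c \<times> 'e) trace set) \<Rightarrow> 'j set \<Rightarrow>
   ('j \<Rightarrow> ('c, 'e) process) \<Rightarrow> ('c, 'e) process" where
  "network_composition \<E> \<T> J N =
     ((\<Union>j\<in>J. fst (N j)),
      {t \<in> \<T> (\<Union>j\<in>J. fst (N j)). \<forall>j\<in>J. restr \<E> (fst (N j)) t \<in> snd (N j)})"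

definition computes ::
  "('c \<Rightarrow> 'e event_structure) \<Rightarrow> ('c set \<Rightarrow> ('c \<times> 'e) trace set) \<Rightarrow> ('c, 'e) process \<Rightarrow>
   'c set \<Rightarrow> 'c set \<Rightarrow> ('c, 'e) val_map set \<Rightarrow> bool" where
  "computes \<E> \<T> p In Out F \<longleftrightarrow>
     fst p = In \<union> Out \<and>
     F \<subseteq> continuous_maps (val_dom \<E> In) (\<subseteq>) (val_dom \<E> Out) (\<subseteq>) \<and>
     (\<forall>t \<in> \<T> (fst p). t \<in> snd p \<longleftrightarrow>
        (\<exists>f\<in>F. restr_val \<E> Out t = f (restr_val \<E> In t) \<and>
               (\<forall>u v. covers_rel (\<T> (fst p)) trace_le t u v \<longrightarrow>
                      restr_val \<E> Out v \<subseteq> f (restr_val \<E> In u))))"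

definition nd_functional_network ::
  "('c \<Rightarrow> 'e event_structure) \<Rightarrow> ('c set \<Rightarrow> ('c \<times> 'e) trace set) \<Rightarrow> 'j set \<Rightarrow>
   ('j \<Rightarrow> ('c, 'e) process) \<Rightarrow> ('j \<Rightarrow> 'c set) \<Rightarrow> ('j \<Rightarrow> 'c set) \<Rightarrow>
   ('j \<Rightarrow> ('c, 'e) val_map set) \<Rightarrow> bool" where
  "nd_functional_network \<E> \<T> J N In Out F \<longleftrightarrow>
     (\<forall>j\<in>J. is_process \<T> (N j) \<and> computes \<E> \<T> (N j) (In j) (Out j) (F j)) \<and>
     (\<forall>\<alpha> \<in> fst (network_composition \<E> \<T> J N). \<exists>!j. j \<in> J \<and> \<alpha> \<in> Out j)"

text \<open>
  An element of \<open>val_dom \<E> S\<close> is the union of its components, which identifies \<open>val_dom \<E> S\<close>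
  with the product of the \<open>val_dom \<E> {\<alpha>}\<close>.
\<close>

definition network_map ::
  "('c \<Rightarrow> 'e event_structure) \<Rightarrow> 'j set \<Rightarrow> 'c set \<Rightarrow> ('j \<Rightarrow> 'c set) \<Rightarrow> ('j \<Rightarrow> 'c set) \<Rightarrow>
   ('j \<Rightarrow> ('c, 'e) val_map) \<Rightarrow> ('c, 'e) val_map" where
  "network_map \<E> J S In Out f x =
     (\<Union>\<alpha>\<in>S. let j = (THE j. j \<in> J \<and> \<alpha> \<in> Out j)
             in proj \<E> {\<alpha>} (f j (proj \<E> (In j) x)))"

text \<open>The lub of a chain of configurations is its union, and the least configuration is empty.\<close>

definition kleene_lfp :: "('c, 'e) val_map \<Rightarrow> ('c \<times> 'e) set" where
  "kleene_lfp G = (\<Union>k. (G ^^ k) {})"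

end

theory Submission
  imports Defs
begin

text \<open>
  A trace \<open>t\<close> of the network is consistent with the choice \<open>f\<close> iff its events form a fixed point of
  \<open>G\<^sub>f\<close> and every event \<open>e\<close> already belongs to \<open>G\<^sub>f\<close> of the strict past of \<open>e\<close> in \<open>t\<close>: covering pairs
  below \<open>t\<close> add a single event to a set containing its strict past. Induction along the finite
  pasts then shows that the events of such a trace all belong to the least fixed point. Conversely,
  each event of the least fixed point has a finite support in an earlier Kleene iterate; these
  supports together with causality generate a partial order with finite pasts. In the linear model
  this order is extended to a linear one of type at most \<open>\<omega>\<close>, which only enlarges the pasts.
\<close>

section \<open>Traces and their restrictions\<close>

text \<open>No downward closure is asked of \<open>y\<close>: the same operation yields the prefixes
  of a trace and, by \<open>restr_eq_subtrace\<close>, its restriction to a sort, which is rarely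
  closed under the trace order.\<close>

definition subtrace :: "'e trace \<Rightarrow> 'e set \<Rightarrow> 'e trace" where
  "subtrace t y = (y, snd t \<inter> y \<times> y)"

definition strict_past :: "'e trace \<Rightarrow> 'e \<Rightarrow> 'e set" where
  "strict_past t e = {e'. (e', e) \<in> snd t \<and> e' \<noteq> e}"

lemma fst_subtrace [simp]: "fst (subtrace t y) = y"
  by (simp add: subtrace_def)

lemma subtrace_subtrace: "z \<subseteq> y \<Longrightarrow> subtrace (subtrace t y) z = subtrace t z"
  by (auto simp: subtrace_def)

lemma configurations_subset:
  assumes "x \<in> configurations X" "y \<subseteq> x"
    and "\<And>e e'. e \<in> y \<Longrightarrow> (e', e) \<in> causality X \<Longrightarrow> e' \<in> y"
  shows "y \<in> configurations X"
  using assms unfolding configurations_def by (auto dest: subset_trans)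

lemma configurations_closed:
  "x \<in> configurations X \<Longrightarrow> e \<in> x \<Longrightarrow> (e', e) \<in> causality X \<Longrightarrow> e' \<in> x"
  by (auto simp: configurations_def)

lemma traces_configurations: "t \<in> traces X \<Longrightarrow> fst t \<in> configurations X"
  by (auto simp: traces_def)

lemma traces_refl: "t \<in> traces X \<Longrightarrow> e \<in> fst t \<Longrightarrow> (e, e) \<in> snd t"
  by (auto simp: traces_def order_on_defs refl_on_def)

lemma traces_field: "t \<in> traces X \<Longrightarrow> (e, e') \<in> snd t \<Longrightarrow> e \<in> fst t \<and> e' \<in> fst t"
  by (auto simp: traces_def order_on_defs)

lemma traces_trans:
  "t \<in> traces X \<Longrightarrow> (a, b) \<in> snd t \<Longrightarrow> (b, c) \<in> snd t \<Longrightarrow> (a, c) \<in> snd t"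
  unfolding traces_def order_on_defs by (auto dest: transD)

lemma traces_antisym:
  "t \<in> traces X \<Longrightarrow> (a, b) \<in> snd t \<Longrightarrow> (b, a) \<in> snd t \<Longrightarrow> a = b"
  unfolding traces_def order_on_defs by (auto dest: antisymD)

lemma traces_causality:
  assumes "t \<in> traces X" "(a, b) \<in> causality X" "b \<in> fst t"
  shows "(a, b) \<in> snd t"
proof -
  have "a \<in> fst t"
    by (rule configurations_closed[OF traces_configurations[OF assms(1)] assms(3,2)])
  moreover have "causality X \<inter> fst t \<times> fst t \<subseteq> snd t"
    using assms(1) by (auto simp: traces_def)
  ultimately show ?thesis using assms(2,3) by blast
qed

lemma traces_finite_past: "t \<in> traces X \<Longrightarrow> finite {e'. (e', e) \<in> snd t}"
proof -
  assume t: "t \<in> traces X"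
  show ?thesis
  proof (cases "e \<in> fst t")
    case True
    then have "finite {e' \<in> fst t. (e', e) \<in> snd t}"
      using t by (auto simp: traces_def)
    moreover have "{e'. (e', e) \<in> snd t} \<subseteq> {e' \<in> fst t. (e', e) \<in> snd t}"
      using traces_field[OF t] by auto
    ultimately show ?thesis by (rule finite_subset[rotated])
  next
    case False
    then have "{e'. (e', e) \<in> snd t} = {}"
      using traces_field[OF t] by auto
    then show ?thesis by simp
  qed
qed

text \<open>The second structure \<open>Y\<close> covers passage to a smaller sort, which changes
  the event structure; for prefixes \<open>Y\<close> is \<open>X\<close> itself.\<close>

lemma subtrace_in_traces:
  assumes t: "t \<in> traces X" and y: "y \<subseteq> fst t" "y \<in> configurations Y"
    and "causality Y \<subseteq> causality X"
  shows "subtrace t y \<in> traces Y"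
proof -
  have "partial_order_on y (snd t \<inter> y \<times> y)"
    using y(1) traces_refl[OF t] traces_trans[OF t] traces_antisym[OF t]
    unfolding order_on_defs refl_on_def trans_def antisym_def by blast
  moreover have "\<forall>e\<in>y. finite {e' \<in> y. (e', e) \<in> snd t \<inter> y \<times> y}"
    by (intro ballI finite_subset[OF _ traces_finite_past[OF t]]) auto
  moreover have "causality Y \<inter> y \<times> y \<subseteq> snd t \<inter> y \<times> y"
    using traces_causality[OF t] y(1) assms(4) by blast
  ultimately show ?thesis
    using y(2) unfolding traces_def subtrace_def by blast
qed

lemma traces_down_closed:
  assumes t: "t \<in> traces X" and "y \<subseteq> fst t"
    and "\<And>e e'. (e, e') \<in> snd t \<Longrightarrow> e' \<in> y \<Longrightarrow> e \<in> y"
  shows "y \<in> configurations X"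
  by (rule configurations_subset[OF traces_configurations[OF t] assms(2)])
    (use assms traces_causality[OF t] in blast)

lemma strict_past_subset: "t \<in> traces X \<Longrightarrow> strict_past t e \<subseteq> fst t"
  unfolding strict_past_def using traces_field by fast

lemma strict_past_down_closed:
  "t \<in> traces X \<Longrightarrow> (a, b) \<in> snd t \<Longrightarrow> b \<in> strict_past t e \<Longrightarrow> a \<in> strict_past t e"
  unfolding strict_past_def using traces_trans[of t X] traces_antisym[of t X] by blast

lemma strict_past_configuration:
  assumes t: "t \<in> traces X"
  shows "strict_past t e \<in> configurations X"
  by (rule traces_down_closed[OF t strict_past_subset[OF t] strict_past_down_closed[OF t]])

section \<open>The prefix order on traces\<close>

lemma trace_le_subset: "trace_le u t \<Longrightarrow> fst u \<subseteq> fst t"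
  by (simp add: trace_le_def)

lemma trace_le_down_closed: "trace_le u t \<Longrightarrow> (a, b) \<in> snd t \<Longrightarrow> b \<in> fst u \<Longrightarrow> a \<in> fst u"
  by (simp add: trace_le_def)

text \<open>A prefix of \<open>t\<close> is determined by its events, so among prefixes of one fixed
  trace all comparisons reduce to inclusions of event sets.\<close>

lemma trace_le_eq_subtrace: "trace_le u t \<Longrightarrow> u = subtrace t (fst u)"
  by (auto simp: trace_le_def subtrace_def prod_eq_iff)

lemma trace_le_iff_subtrace:
  "trace_le (subtrace t y) t \<longleftrightarrow> y \<subseteq> fst t \<and> (\<forall>e e'. (e, e') \<in> snd t \<longrightarrow> e' \<in> y \<longrightarrow> e \<in> y)"
  by (auto simp: trace_le_def subtrace_def)

lemma trace_le_subtrace_mono: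
  "trace_le (subtrace t y) t \<Longrightarrow> y \<subseteq> z \<Longrightarrow> trace_le (subtrace t y) (subtrace t z)"
  unfolding trace_le_iff_subtrace by (auto simp: trace_le_def subtrace_def)

lemma strict_past_subtrace: "e \<in> y \<Longrightarrow> strict_past (subtrace t y) e = strict_past t e \<inter> y"
  by (auto simp: strict_past_def subtrace_def)


section \<open>Fixed points of continuous maps on configurations\<close>

lemma continuous_maps_mono:
  assumes "f \<in> continuous_maps D (\<subseteq>) D' (\<subseteq>)" "x \<in> D" "y \<in> D" "x \<subseteq> y"
  shows "f x \<subseteq> f y"
proof -
  have "directed_in D (\<subseteq>) {x, y}" "lub_in D (\<subseteq>) {x, y} y"
    using assms by (auto simp: directed_in_def lub_in_def)
  then have "lub_in D' (\<subseteq>) (f ` {x, y}) (f y)"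
    using assms(1) unfolding continuous_maps_def by blast
  then show ?thesis by (auto simp: lub_in_def)
qed

section \<open>Finite supports of continuous maps\<close>

locale finitary_es =
  fixes X :: "'e event_structure"
  assumes causality_order: "partial_order_on (events X) (causality X)"
    and finite_causes: "finite {e'. (e', e) \<in> causality X}"
    and empty_configuration: "{} \<in> configurations X"
begin

lemma causality_trans:
  "(a, b) \<in> causality X \<Longrightarrow> (b, c) \<in> causality X \<Longrightarrow> (a, c) \<in> causality X"
  using causality_order by (auto simp: order_on_defs dest: transD)

lemma causality_antisym: "(a, b) \<in> causality X \<Longrightarrow> (b, a) \<in> causality X \<Longrightarrow> a = b"
  using causality_order by (auto simp: order_on_defs dest: antisymD)

lemma causality_refl: "e \<in> events X \<Longrightarrow> (e, e) \<in> causality X"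
  using causality_order by (auto simp: order_on_defs refl_on_def)

text \<open>Since every event has finitely many causes, \<open>y\<close> is the directed union of
  its finite subconfigurations, and a continuous map preserves this lub.\<close>

lemma continuous_maps_finite_support:
  assumes f: "f \<in> continuous_maps (configurations X) (\<subseteq>) (configurations Y) (\<subseteq>)"
    and y: "y \<in> configurations X" and e: "e \<in> f y"
  obtains y0 where "finite y0" "y0 \<subseteq> y" "y0 \<in> configurations X" "e \<in> f y0"
proof -
  define A where "A = {y0. finite y0 \<and> y0 \<subseteq> y \<and> y0 \<in> configurations X}"
  have un: "a \<union> b \<in> A" if "a \<in> A" "b \<in> A" for a b
  proof -
    have "a \<union> b \<in> configurations X"
      by (rule configurations_subset[OF y])
        (use that configurations_closed[of a] configurations_closed[of b] in \<open>auto simp: A_def\<close>)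
    then show ?thesis using that by (auto simp: A_def)
  qed
  have dir: "directed_in (configurations X) (\<subseteq>) A"
    unfolding directed_in_def
  proof (intro conjI ballI)
    show "A \<subseteq> configurations X" by (auto simp: A_def)
    show "A \<noteq> {}" using empty_configuration by (auto simp: A_def)
    show "\<exists>c\<in>A. a \<subseteq> c \<and> b \<subseteq> c" if "a \<in> A" "b \<in> A" for a b
      using un[OF that] by blast
  qed
  have princ: "{a. (a, b) \<in> causality X} \<in> A" if "b \<in> y" for b
  proof -
    have "{a. (a, b) \<in> causality X} \<in> configurations X"
      by (rule configurations_subset[OF y])
        (use that configurations_closed[OF y] causality_trans in auto)
    then show ?thesis
      using finite_causes that configurations_closed[OF y] by (auto simp: A_def)
  qed
  have "y \<subseteq> z" if "\<forall>a\<in>A. a \<subseteq> z" for z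
  proof
    fix b assume b: "b \<in> y"
    then have "b \<in> {a. (a, b) \<in> causality X}"
      using y causality_refl by (auto simp: configurations_def)
    then show "b \<in> z" using bspec[OF that princ[OF b]] by (rule subsetD[rotated])
  qed
  moreover have "\<forall>a\<in>A. a \<subseteq> y" by (auto simp: A_def)
  ultimately have "lub_in (configurations X) (\<subseteq>) A y"
    using y by (simp add: lub_in_def)
  then have lub: "lub_in (configurations Y) (\<subseteq>) (f ` A) (f y)"
    using f dir unfolding continuous_maps_def by blast
  then have fy: "f y \<in> configurations Y" by (simp add: lub_in_def)
  have fA: "f a \<in> configurations Y" if "a \<in> A" for a
    using f that by (auto simp: continuous_maps_def A_def)
  \<comment> \<open>The intersection with \<open>f y\<close> makes consistency of the union
    immediate, as \<open>?z\<close> lies inside a configuration. It still bounds all values on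
    \<open>A\<close>, so leastness of \<open>f y\<close> forces \<open>f y\<close> into the
    union.\<close>
  let ?z = "f y \<inter> \<Union> (f ` A)"
  have z: "?z \<in> configurations Y"
  proof (rule configurations_subset[OF fy])
    fix b a assume "b \<in> ?z" and ab: "(a, b) \<in> causality Y"
    then obtain c where c: "c \<in> A" "b \<in> f c" "b \<in> f y" by blast
    have "a \<in> f c" "a \<in> f y"
      using configurations_closed[OF fA[OF c(1)] c(2) ab]
        configurations_closed[OF fy c(3) ab] by auto
    then show "a \<in> ?z" using c(1) by blast
  qed auto
  have "\<forall>a\<in>f ` A. a \<subseteq> ?z" using lub unfolding lub_in_def by blast
  then have "f y \<subseteq> ?z" using lub z unfolding lub_in_def by blast
  then obtain a where "a \<in> A" "e \<in> f a" using e by blast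
  then show thesis using that unfolding A_def by blast
qed

end

section \<open>Kleene iterates and the traces they generate\<close>

locale finitary_map = finitary_es X for X :: "'e event_structure" +
  fixes G :: "'e set \<Rightarrow> 'e set"
  assumes G_configurations: "x \<in> configurations X \<Longrightarrow> G x \<in> configurations X"
    and G_mono: "x \<in> configurations X \<Longrightarrow> y \<in> configurations X \<Longrightarrow> x \<subseteq> y \<Longrightarrow> G x \<subseteq> G y"
    and G_finite_support: "y \<in> configurations X \<Longrightarrow> e \<in> G y \<Longrightarrow>
      \<exists>y0. finite y0 \<and> y0 \<subseteq> y \<and> y0 \<in> configurations X \<and> e \<in> G y0"
begin

definition iter :: "nat \<Rightarrow> 'e set" where
  "iter k = (G ^^ k) {}"

definition lfp_G :: "'e set" where
  "lfp_G = (\<Union>k. iter k)"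

lemma iter_0 [simp]: "iter 0 = {}" and iter_Suc: "iter (Suc k) = G (iter k)"
  by (simp_all add: iter_def)

lemma iter_configurations: "iter k \<in> configurations X"
  by (induction k) (auto simp: iter_Suc empty_configuration G_configurations)

lemma iter_mono: "k \<le> l \<Longrightarrow> iter k \<subseteq> iter l"
proof -
  have "iter k \<subseteq> iter (Suc k)" for k
  proof (induction k)
    case (Suc k)
    then have "G (iter k) \<subseteq> G (iter (Suc k))"
      by (intro G_mono iter_configurations)
    then show ?case by (simp add: iter_Suc)
  qed auto
  then show "k \<le> l \<Longrightarrow> iter k \<subseteq> iter l" by (rule lift_Suc_mono_le)
qed

lemma finite_subset_lfp:
  assumes "finite A" "A \<subseteq> lfp_G"
  obtains k where "A \<subseteq> iter k"
proof -
  have "\<exists>k. A \<subseteq> iter k" using assms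
  proof (induction A)
    case (insert a A)
    then obtain k l where "A \<subseteq> iter k" "a \<in> iter l" by (auto simp: lfp_G_def)
    then have "insert a A \<subseteq> iter (max k l)"
      using iter_mono[of k "max k l"] iter_mono[of l "max k l"] by auto
    then show ?case ..
  qed auto
  then show thesis using that by blast
qed

text \<open>The iterates form a chain, so a finite subset of their union already lies in one of them
  and is consistent there.\<close>

lemma lfp_configurations: "lfp_G \<in> configurations X"
proof -
  have "A \<in> consistent X" if "A \<subseteq> lfp_G" "finite A" for A
    using finite_subset_lfp[OF that(2,1)] that iter_configurations
    by (metis (no_types, lifting) configurations_def mem_Collect_eq)
  moreover have "lfp_G \<subseteq> events X"
    using iter_configurations unfolding lfp_G_def configurations_def by blast
  moreover have "e' \<in> lfp_G" if "e \<in> lfp_G" "(e', e) \<in> causality X" for e e'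
    using that configurations_closed[OF iter_configurations] by (auto simp: lfp_G_def)
  ultimately show ?thesis unfolding configurations_def by blast
qed

lemma iter_subset_lfp: "iter k \<subseteq> lfp_G"
  by (auto simp: lfp_G_def)

lemma G_lfp: "G lfp_G = lfp_G"
proof
  show "G lfp_G \<subseteq> lfp_G"
  proof
    fix e assume "e \<in> G lfp_G"
    then obtain y where y: "finite y" "y \<subseteq> lfp_G" "y \<in> configurations X" "e \<in> G y"
      using G_finite_support[OF lfp_configurations] by blast
    then obtain k where "y \<subseteq> iter k" using finite_subset_lfp by blast
    then have "e \<in> iter (Suc k)"
      using y G_mono[OF y(3) iter_configurations] by (auto simp: iter_Suc)
    then show "e \<in> lfp_G" using iter_subset_lfp by blast
  qed
  show "lfp_G \<subseteq> G lfp_G"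
  proof
    fix e assume "e \<in> lfp_G"
    then obtain k where k: "e \<in> iter k" by (auto simp: lfp_G_def)
    then obtain l where "k = Suc l" by (cases k) auto
    then show "e \<in> G lfp_G"
      using k G_mono[OF iter_configurations lfp_configurations iter_subset_lfp]
      by (auto simp: iter_Suc)
  qed
qed

lemma lfp_least:
  assumes "x \<in> configurations X" "G x = x"
  shows "lfp_G \<subseteq> x"
proof -
  have "iter k \<subseteq> x" for k
  proof (induction k)
    case (Suc k)
    then show ?case using G_mono[OF iter_configurations assms(1)] assms(2) by (auto simp: iter_Suc)
  qed auto
  then show ?thesis by (auto simp: lfp_G_def)
qed

text \<open>Being a fixed point gives only one inclusion. Generation from strict pasts excludes
  larger fixed points: once the strict past of \<open>e\<close> lies in \<open>lfp_G\<close>,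
  monotonicity puts \<open>e\<close> into \<open>G lfp_G = lfp_G\<close>.\<close>

lemma generated_trace_lfp:
  assumes t: "t \<in> traces X" and fix_t: "G (fst t) = fst t"
    and gen: "\<And>e. e \<in> fst t \<Longrightarrow> e \<in> G (strict_past t e)"
  shows "fst t = lfp_G"
proof
  show "lfp_G \<subseteq> fst t"
    using lfp_least traces_configurations[OF t] fix_t by blast
  have "e \<in> lfp_G" if "e \<in> fst t" for e
    using that
  \<comment> \<open>Pasts are finite, and a strict predecessor has a strictly smaller past.\<close>
  proof (induction "card {a. (a, e) \<in> snd t}" arbitrary: e rule: less_induct)
    case less
    have "a \<in> lfp_G" if a: "a \<in> strict_past t e" for a
    proof (rule less.hyps)
      have ae: "(a, e) \<in> snd t" "a \<noteq> e" using a by (auto simp: strict_past_def)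
      then have "{b. (b, a) \<in> snd t} \<subset> {b. (b, e) \<in> snd t}"
        using traces_trans[OF t] traces_antisym[OF t] traces_refl[OF t less.prems] by blast
      then show "card {b. (b, a) \<in> snd t} < card {b. (b, e) \<in> snd t}"
        by (rule psubset_card_mono[OF traces_finite_past[OF t]])
      show "a \<in> fst t" using ae traces_field[OF t] by blast
    qed
    then have "strict_past t e \<subseteq> lfp_G" by blast
    then have "G (strict_past t e) \<subseteq> lfp_G"
      using G_mono[OF strict_past_configuration[OF t] lfp_configurations] G_lfp by metis
    then show ?case using gen[OF less.prems] by blast
  qed
  then show "fst t \<subseteq> lfp_G" by blast
qed

text \<open>As \<open>iter 0\<close> is empty, the first iterate containing \<open>e\<close> is a
  successor. The truncated subtraction is therefore exact, and the support is found in the iterate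
  just before.\<close>

lemma finite_support_of_lfp:
  assumes "e \<in> lfp_G"
  shows "\<exists>y. finite y \<and> y \<in> configurations X \<and> e \<in> G y \<and> y \<subseteq> iter ((LEAST k. e \<in> iter k) - 1)"
proof -
  let ?k = "LEAST k. e \<in> iter k"
  have e: "e \<in> iter ?k" using assms unfolding lfp_G_def by (auto intro: LeastI)
  then obtain l where l: "?k = Suc l" by (cases ?k) auto
  then have "e \<in> G (iter l)" using e by (simp add: iter_Suc)
  then show ?thesis
    using G_finite_support[OF iter_configurations] l by (metis diff_Suc_1)
qed

text \<open>The trace order is the reflexive transitive closure of a relation that puts before each
  event its chosen support and its causes, and nothing more. Wellfoundedness of this relation gives
  both antisymmetry and finite pasts.\<close>

lemma ex_generated_trace:
  obtains t where "t \<in> traces X" "fst t = lfp_G" "\<And>e. e \<in> lfp_G \<Longrightarrow> e \<in> G (strict_past t e)"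
proof -
  define rank where "rank e = (LEAST k. e \<in> iter k)" for e
  obtain Y where Y: "\<And>e. e \<in> lfp_G \<Longrightarrow> finite (Y e) \<and> Y e \<in> configurations X \<and> e \<in> G (Y e)
      \<and> Y e \<subseteq> iter (rank e - 1)"
    using finite_support_of_lfp unfolding rank_def by metis
  have rank: "rank a \<le> k" if "a \<in> iter k" for a k
    using that unfolding rank_def by (rule Least_le)
  have rank_in: "a \<in> iter (rank a)" if "a \<in> lfp_G" for a
    using that unfolding rank_def lfp_G_def by (auto intro: LeastI)
  have rank_pos: "rank a > 0" if "a \<in> lfp_G" for a
    using rank_in[OF that] by (cases "rank a") auto
  have Y_rank: "rank a < rank b" if "b \<in> lfp_G" "a \<in> Y b" for a b
    using rank[of a "rank b - 1"] rank_pos[OF that(1)] Y[OF that(1)] that(2) by fastforce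
  define R where "R = {(a, b). b \<in> lfp_G \<and> (a \<in> Y b \<or> (a, b) \<in> causality X \<and> a \<noteq> b)}"
  \<comment> \<open>A support has strictly smaller rank, but a proper cause may enter at the same
    iterate as its effect. The number of causes breaks the tie, so the pair of \<open>rank\<close>
    and \<open>c\<close> decreases lexicographically along \<open>R\<close>.\<close>
  define c where "c e = card {a. (a, e) \<in> causality X}" for e
  have wf: "wf R"
  proof (rule wf_subset)
    show "wf (inv_image (less_than <*lex*> less_than) (\<lambda>e. (rank e, c e)))" by auto
    show "R \<subseteq> inv_image (less_than <*lex*> less_than) (\<lambda>e. (rank e, c e))"
    proof
      fix p assume "p \<in> R"
      then obtain a b where p: "p = (a, b)" and b: "b \<in> lfp_G"
        and ab: "a \<in> Y b \<or> (a, b) \<in> causality X \<and> a \<noteq> b" by (auto simp: R_def)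
      have "rank a < rank b \<or> rank a \<le> rank b \<and> c a < c b"
      proof (cases "a \<in> Y b")
        case False
        then have ca: "(a, b) \<in> causality X" "a \<noteq> b" using ab by auto
        have "rank a \<le> rank b"
          using configurations_closed[OF iter_configurations rank_in[OF b] ca(1)] by (rule rank)
        moreover have "b \<in> events X"
          using b lfp_configurations by (auto simp: configurations_def)
        then have "{e. (e, a) \<in> causality X} \<subset> {e. (e, b) \<in> causality X}"
          using ca causality_trans causality_antisym causality_refl by blast
        then have "c a < c b"
          unfolding c_def by (rule psubset_card_mono[OF finite_causes])
        ultimately show ?thesis by blast
      qed (use Y_rank b in blast)
      then show "p \<in> inv_image (less_than <*lex*> less_than) (\<lambda>e. (rank e, c e))"
        using p by auto
    qed
  qed
  have R_in: "a \<in> lfp_G" if "(a, b) \<in> R" for a b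
    using that Y iter_subset_lfp configurations_closed[OF lfp_configurations] unfolding R_def by blast
  \<comment> \<open>Each event has finitely many immediate predecessors, from its finite support and
    its finite set of causes; wellfounded induction carries finiteness over to the whole
    past.\<close>
  have fin: "finite {a. (a, e) \<in> R\<^sup>*}" for e
    using wf
  proof (induction e rule: wf_induct_rule)
    case (less e)
    have "finite {a. (a, e) \<in> R}"
    proof (cases "e \<in> lfp_G")
      case True
      then have "finite (Y e \<union> {a. (a, e) \<in> causality X})" using Y finite_causes by auto
      then show ?thesis by (rule finite_subset[rotated]) (auto simp: R_def)
    qed (simp add: R_def)
    then have "finite (insert e (\<Union>b\<in>{b. (b, e) \<in> R}. {a. (a, b) \<in> R\<^sup>*}))"
      using less by auto
    moreover have "{a. (a, e) \<in> R\<^sup>*} \<subseteq> insert e (\<Union>b\<in>{b. (b, e) \<in> R}. {a. (a, b) \<in> R\<^sup>*})"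
      by (auto elim: rtranclE)
    ultimately show ?case by (rule finite_subset[rotated])
  qed
  let ?t = "(lfp_G, R\<^sup>* \<inter> lfp_G \<times> lfp_G)"
  have t: "?t \<in> traces X"
  proof -
    have "antisym (R\<^sup>*)" by (intro acyclic_impl_antisym_rtrancl wf_acyclic wf)
    then have "partial_order_on lfp_G (R\<^sup>* \<inter> lfp_G \<times> lfp_G)"
      unfolding order_on_defs refl_on_def trans_def antisym_def by (auto dest: rtrancl_trans)
    moreover have "\<forall>e\<in>lfp_G. finite {e' \<in> lfp_G. (e', e) \<in> R\<^sup>* \<inter> lfp_G \<times> lfp_G}"
      by (intro ballI finite_subset[OF _ fin]) auto
    moreover have "causality X \<inter> lfp_G \<times> lfp_G \<subseteq> R\<^sup>*"
    proof
      fix p assume p: "p \<in> causality X \<inter> lfp_G \<times> lfp_G"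
      obtain a b where ab: "p = (a, b)" by force
      then have "a = b \<or> (a, b) \<in> R" using p by (auto simp: R_def)
      then show "p \<in> R\<^sup>*" using ab by auto
    qed
    ultimately show ?thesis
      using lfp_configurations unfolding traces_def by blast
  qed
  have "e \<in> G (strict_past ?t e)" if e: "e \<in> lfp_G" for e
  proof -
    \<comment> \<open>Members of \<open>Y e\<close> have smaller rank than \<open>e\<close>, so
      \<open>e\<close> is not among them and the support falls into the strict past.\<close>
    have "Y e \<subseteq> strict_past ?t e"
    proof
      fix a assume a: "a \<in> Y e"
      then have "(a, e) \<in> R" using e by (simp add: R_def)
      then show "a \<in> strict_past ?t e"
        using e R_in Y_rank[OF e a] by (auto simp: strict_past_def)
    qed
    then show ?thesis
      using G_mono[OF _ strict_past_configuration[OF t]] Y[OF e] by blast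
  qed
  then show thesis using that[of ?t] t by auto
qed

end

text \<open>An arbitrary linear extension may have infinite pasts. Enumerating the events allows an
  extension in which each new past is covered by finitely many old ones.\<close>

lemma ex_linear_extension:
  assumes t: "t \<in> traces X" and "countable (fst t)"
  obtains t' where "t' \<in> linear_traces X" "fst t' = fst t" "snd t \<subseteq> snd t'"
proof -
  define i where "i = to_nat_on (fst t)"
  have inj: "inj_on i (fst t)" unfolding i_def by (rule inj_on_to_nat_on[OF assms(2)])
  \<comment> \<open>Order first by the earliest enumerated event above, so that pasts stay finite, and then by
    the size of the past, which is strictly monotone.\<close>
  define m where "m e = (LEAST n. \<exists>b\<in>fst t. i b = n \<and> (e, b) \<in> snd t)" for e
  define c where "c e = card {a. (a, e) \<in> snd t}" for e
  have m: "\<exists>b\<in>fst t. i b = m e \<and> (e, b) \<in> snd t" if "e \<in> fst t" for e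
    unfolding m_def by (rule LeastI[of _ "i e"]) (use that traces_refl[OF t] in blast)
  have m_mono: "m a \<le> m b" if ab: "(a, b) \<in> snd t" for a b
  proof -
    obtain d where "d \<in> fst t" "i d = m b" "(b, d) \<in> snd t"
      using m traces_field[OF t ab] by blast
    then show ?thesis
      unfolding m_def[of a] using traces_trans[OF t ab] by (intro Least_le) blast
  qed
  have c_mono: "c a < c b" if ab: "(a, b) \<in> snd t" "a \<noteq> b" for a b
  proof -
    have "{e. (e, a) \<in> snd t} \<subset> {e. (e, b) \<in> snd t}"
      using ab traces_trans[OF t] traces_antisym[OF t] traces_refl[OF t] traces_field[OF t ab(1)]
      by blast
    then show ?thesis
      unfolding c_def by (rule psubset_card_mono[OF traces_finite_past[OF t]])
  qed
  \<comment> \<open>Both \<open>m\<close> and \<open>c\<close> respect the old order. The injective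
    enumeration \<open>i\<close> comes last and only separates events that agree in both, which
    yields totality and antisymmetry.\<close>
  define r where "r = {(a, b). a \<in> fst t \<and> b \<in> fst t \<and>
    (m a < m b \<or> m a = m b \<and> (c a < c b \<or> c a = c b \<and> i a \<le> i b))}"
  have lin: "linear_order_on (fst t) r"
    unfolding order_on_defs
  proof (intro conjI)
    show "r \<subseteq> fst t \<times> fst t" "refl_on (fst t) r" "trans r"
      by (auto simp: r_def refl_on_def trans_def)
    show "antisym r" "total_on (fst t) r"
      using inj by (auto simp: r_def antisym_def total_on_def dest: inj_onD)
  qed
  have sub: "snd t \<subseteq> r"
  proof
    fix p assume p: "p \<in> snd t"
    obtain a b where ab: "p = (a, b)" by force
    then have "a \<in> fst t" "b \<in> fst t" "m a \<le> m b" "a = b \<or> c a < c b"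
      using p traces_field[OF t] m_mono c_mono by blast+
    then show "p \<in> r" using ab by (auto simp: r_def)
  qed
  \<comment> \<open>An event \<open>a\<close> placed before \<open>e\<close> satisfies
    \<open>m a \<le> m e\<close>, so it lies in the old past of some \<open>b\<close> with
    \<open>i b \<le> m e\<close>. There are finitely many such \<open>b\<close>, and each has a
    finite old past.\<close>
  have "finite {a \<in> fst t. (a, e) \<in> r}" for e
  proof (rule finite_subset)
    have "finite {b \<in> fst t. i b \<le> m e}"
      by (rule inj_on_finite[of i _ "{..m e}"]) (use inj in \<open>auto intro: inj_on_subset\<close>)
    then show "finite (\<Union>b\<in>{b \<in> fst t. i b \<le> m e}. {a. (a, b) \<in> snd t})"
      using traces_finite_past[OF t] by blast
    show "{a \<in> fst t. (a, e) \<in> r} \<subseteq> (\<Union>b\<in>{b \<in> fst t. i b \<le> m e}. {a. (a, b) \<in> snd t})"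
    proof
      fix a assume a: "a \<in> {a \<in> fst t. (a, e) \<in> r}"
      then have "m a \<le> m e" by (auto simp: r_def)
      then show "a \<in> (\<Union>b\<in>{b \<in> fst t. i b \<le> m e}. {a. (a, b) \<in> snd t})"
        using m[of a] a by fastforce
    qed
  qed
  moreover have "causality X \<inter> fst t \<times> fst t \<subseteq> r"
    using traces_causality[OF t] sub by blast
  ultimately have "(fst t, r) \<in> linear_traces X"
    using lin traces_configurations[OF t]
    unfolding linear_traces_def traces_def linear_order_on_def by auto
  then show thesis using that[of "(fst t, r)"] sub by simp
qed


section \<open>Values and traces over a sort\<close>

lemma events_sort_es [simp]: "events (sort_es \<E> S) = {(\<alpha>, e). \<alpha> \<in> S \<and> e \<in> events (\<E> \<alpha>)}"
  and causality_sort_es [simp]: "causality (sort_es \<E> S) =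
    {((\<alpha>, e), (\<beta>, e')). \<alpha> = \<beta> \<and> \<alpha> \<in> S \<and> (e, e') \<in> causality (\<E> \<alpha>)}"
  by (simp_all add: sort_es_def)

text \<open>This is the identification of the value domain with a product over channels: causality
  never links two channels, and consistency of a finite set is tested channel by channel.\<close>

lemma val_dom_iff:
  "x \<in> val_dom \<E> S \<longleftrightarrow> fst ` x \<subseteq> S \<and> (\<forall>\<alpha>\<in>S. {e. (\<alpha>, e) \<in> x} \<in> configurations (\<E> \<alpha>))"
proof
  assume x: "x \<in> val_dom \<E> S"
  have "{e. (\<alpha>, e) \<in> x} \<in> configurations (\<E> \<alpha>)" if \<alpha>: "\<alpha> \<in> S" for \<alpha>
    unfolding configurations_def
  proof (rule CollectI, intro conjI allI ballI impI)
    show "{e. (\<alpha>, e) \<in> x} \<subseteq> events (\<E> \<alpha>)"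
      using x by (auto simp: val_dom_def configurations_def)
    show "e' \<in> {e. (\<alpha>, e) \<in> x}"
      if "e \<in> {e. (\<alpha>, e) \<in> x}" "(e', e) \<in> causality (\<E> \<alpha>)" for e e'
      using configurations_closed[OF x[unfolded val_dom_def], of "(\<alpha>, e)" "(\<alpha>, e')"] that \<alpha> by simp
    fix A assume A: "A \<subseteq> {e. (\<alpha>, e) \<in> x}" "finite A"
    have "{\<alpha>} \<times> A \<subseteq> x" "finite ({\<alpha>} \<times> A)" using A by auto
    then have "{\<alpha>} \<times> A \<in> consistent (sort_es \<E> S)"
      using x unfolding val_dom_def configurations_def by blast
    then have "{e. (\<alpha>, e) \<in> {\<alpha>} \<times> A} \<in> consistent (\<E> \<alpha>)"
      using \<alpha> unfolding sort_es_def by auto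
    then show "A \<in> consistent (\<E> \<alpha>)" by simp
  qed
  then show "fst ` x \<subseteq> S \<and> (\<forall>\<alpha>\<in>S. {e. (\<alpha>, e) \<in> x} \<in> configurations (\<E> \<alpha>))"
    using x by (auto simp: val_dom_def configurations_def)
next
  assume "fst ` x \<subseteq> S \<and> (\<forall>\<alpha>\<in>S. {e. (\<alpha>, e) \<in> x} \<in> configurations (\<E> \<alpha>))"
  then have S: "\<And>\<alpha> e. (\<alpha>, e) \<in> x \<Longrightarrow> \<alpha> \<in> S"
    and C: "\<And>\<alpha>. \<alpha> \<in> S \<Longrightarrow> {e. (\<alpha>, e) \<in> x} \<in> configurations (\<E> \<alpha>)" by auto
  have ev: "e \<in> events (\<E> \<alpha>)" if "(\<alpha>, e) \<in> x" for \<alpha> e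
    using C[OF S[OF that]] that by (auto simp: configurations_def)
  show "x \<in> val_dom \<E> S"
    unfolding val_dom_def configurations_def
  proof (rule CollectI, intro conjI allI ballI impI)
    show sub: "x \<subseteq> events (sort_es \<E> S)" using S ev by auto
    show "p' \<in> x" if "p \<in> x" "(p', p) \<in> causality (sort_es \<E> S)" for p p'
    proof -
      obtain \<alpha> e e' where p: "p = (\<alpha>, e)" "p' = (\<alpha>, e')" "\<alpha> \<in> S" "(e', e) \<in> causality (\<E> \<alpha>)"
        using \<open>(p', p) \<in> causality (sort_es \<E> S)\<close> by auto
      then have "e' \<in> {e. (\<alpha>, e) \<in> x}"
        using \<open>p \<in> x\<close> by (intro configurations_closed[OF C[OF p(3)] _ p(4)]) simp
      then show ?thesis using p(2) by simp
    qed
    fix A assume A: "A \<subseteq> x" "finite A"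
    have "{e. (\<alpha>, e) \<in> A} \<in> consistent (\<E> \<alpha>)" if \<alpha>: "\<alpha> \<in> S" for \<alpha>
    proof -
      have "{e. (\<alpha>, e) \<in> A} = snd ` (A \<inter> {\<alpha>} \<times> UNIV)" by force
      then have "finite {e. (\<alpha>, e) \<in> A}" using A by simp
      moreover have "{e. (\<alpha>, e) \<in> A} \<subseteq> {e. (\<alpha>, e) \<in> x}" using A by auto
      ultimately show ?thesis using C[OF \<alpha>] unfolding configurations_def by blast
    qed
    then show "A \<in> consistent (sort_es \<E> S)"
      using A sub by (simp add: sort_es_def)
  qed
qed

section \<open>Projections between sorts\<close>

lemma proj_eq: "x \<in> val_dom \<E> S \<Longrightarrow> proj \<E> T x = {p \<in> x. fst p \<in> T}"
  by (auto simp: proj_def val_dom_def configurations_def)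

lemma proj_val_dom:
  assumes "x \<in> val_dom \<E> S" "T \<subseteq> S"
  shows "proj \<E> T x \<in> val_dom \<E> T"
proof -
  have "{e. (\<alpha>, e) \<in> {p \<in> x. fst p \<in> T}} = {e. (\<alpha>, e) \<in> x}" if "\<alpha> \<in> T" for \<alpha>
    using that by auto
  then show ?thesis
    using assms unfolding proj_eq[OF assms(1)] val_dom_iff by (auto simp: subset_iff)
qed

lemma proj_mono: "x \<subseteq> y \<Longrightarrow> proj \<E> T x \<subseteq> proj \<E> T y"
  by (auto simp: proj_def)

lemma mem_proj: "x \<in> val_dom \<E> S \<Longrightarrow> p \<in> proj \<E> T x \<longleftrightarrow> p \<in> x \<and> fst p \<in> T"
  by (simp add: proj_eq)

lemma restr_val_eq: "restr_val \<E> T t = proj \<E> T (fst t)"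
  by (simp add: restr_val_def eval_trace_def restr_def proj_def)

lemma empty_configuration:
  assumes "prime_event_structure X"
  shows "{} \<in> configurations X"
  using assms by (auto simp: configurations_def prime_event_structure_def)

text \<open>The channels outside \<open>T\<close> contribute the empty configuration. This lets a
  finite support found among the inputs of one node count as a value of the whole network.\<close>

lemma val_dom_superset:
  assumes "\<And>\<alpha>. prime_event_structure (\<E> \<alpha>)" and x: "x \<in> val_dom \<E> T" and "T \<subseteq> S"
  shows "x \<in> val_dom \<E> S"
proof -
  have "{e. (\<alpha>, e) \<in> x} \<in> configurations (\<E> \<alpha>)" for \<alpha>
  proof (cases "\<alpha> \<in> T")
    case True
    then show ?thesis using x by (simp add: val_dom_iff)
  next
    case False
    then have "{e. (\<alpha>, e) \<in> x} = {}" using x by (auto simp: val_dom_iff)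
    then show ?thesis using empty_configuration assms(1) by metis
  qed
  then show ?thesis using x assms(3) by (auto simp: val_dom_iff)
qed

lemma finitary_sort_es:
  assumes "\<And>\<alpha>. prime_event_structure (\<E> \<alpha>)"
  shows "finitary_es (sort_es \<E> S)"
proof
  have po: "partial_order_on (events (\<E> \<alpha>)) (causality (\<E> \<alpha>))" for \<alpha>
    using assms by (simp add: prime_event_structure_def)
  then have "causality (\<E> \<alpha>) \<subseteq> events (\<E> \<alpha>) \<times> events (\<E> \<alpha>)"
    "refl_on (events (\<E> \<alpha>)) (causality (\<E> \<alpha>))" "trans (causality (\<E> \<alpha>))"
    "antisym (causality (\<E> \<alpha>))" for \<alpha>
    unfolding order_on_defs by blast+
  then show "partial_order_on (events (sort_es \<E> S)) (causality (sort_es \<E> S))"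
    unfolding order_on_defs refl_on_def trans_def antisym_def by fastforce
  show "finite {p'. (p', p) \<in> causality (sort_es \<E> S)}" for p
  proof (cases p)
    case (Pair \<alpha> e)
    have "finite {e'. (e', e) \<in> causality (\<E> \<alpha>)}"
    proof (cases "e \<in> events (\<E> \<alpha>)")
      case True
      then show ?thesis using assms by (simp add: prime_event_structure_def)
    next
      case False
      then have "{e'. (e', e) \<in> causality (\<E> \<alpha>)} = {}"
        using po[of \<alpha>] by (auto simp: order_on_defs)
      then show ?thesis by simp
    qed
    then have "finite (Pair \<alpha> ` {e'. (e', e) \<in> causality (\<E> \<alpha>)})" by simp
    then show ?thesis by (rule finite_subset[rotated]) (auto simp: Pair)
  qed
  have "{} \<in> val_dom \<E> S"
    by (simp add: val_dom_iff empty_configuration[OF assms])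
  then show "{} \<in> configurations (sort_es \<E> S)" by (simp add: val_dom_def)
qed

text \<open>The properties shared by \<open>model_P\<close> and \<open>model_L\<close>: trace
  domains consist of traces and are stable under cutting down to a subset that again carries a
  trace. The two sorts in the last assumption may differ, so that it serves prefixes and
  restrictions alike.\<close>

locale trace_model =
  fixes \<E> :: "'c \<Rightarrow> 'e event_structure"
    and \<T> :: "'c set \<Rightarrow> ('c \<times> 'e) trace set"
  assumes es: "prime_event_structure (\<E> \<alpha>)"
    and \<T>_traces: "t \<in> \<T> S \<Longrightarrow> t \<in> traces (sort_es \<E> S)"
    and \<T>_subtrace: "t \<in> \<T> S \<Longrightarrow> x \<subseteq> fst t \<Longrightarrow> subtrace t x \<in> traces (sort_es \<E> S') \<Longrightarrow> subtrace t x \<in> \<T> S'"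
begin

lemma fst_val_dom: "t \<in> \<T> S \<Longrightarrow> fst t \<in> val_dom \<E> S"
  unfolding val_dom_def by (intro traces_configurations \<T>_traces)

lemma strict_past_val_dom: "t \<in> \<T> S \<Longrightarrow> strict_past t e \<in> val_dom \<E> S"
  unfolding val_dom_def by (intro strict_past_configuration \<T>_traces)

lemma down_subtrace_in_\<T>:
  assumes t: "t \<in> \<T> S" and le: "trace_le (subtrace t y) t"
  shows "subtrace t y \<in> \<T> S"
proof -
  have y: "y \<subseteq> fst t" "\<And>e e'. (e, e') \<in> snd t \<Longrightarrow> e' \<in> y \<Longrightarrow> e \<in> y"
    using le unfolding trace_le_iff_subtrace by auto
  show ?thesis
    by (rule \<T>_subtrace[OF t y(1)], rule subtrace_in_traces[OF \<T>_traces[OF t] y(1)])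
      (use traces_down_closed[OF \<T>_traces[OF t] y] in auto)
qed

lemma restr_eq_subtrace:
  assumes "t \<in> \<T> S"
  shows "restr \<E> T t = subtrace t (proj \<E> T (fst t))"
  using traces_field[OF \<T>_traces[OF assms]] by (auto simp: restr_def subtrace_def proj_def)

lemma restr_in_\<T>:
  assumes t: "t \<in> \<T> S" and "T \<subseteq> S"
  shows "restr \<E> T t \<in> \<T> T"
proof -
  let ?y = "proj \<E> T (fst t)"
  have y: "?y \<subseteq> fst t" by (auto simp: proj_def)
  have "?y \<in> configurations (sort_es \<E> T)"
    using proj_val_dom[OF fst_val_dom[OF t] assms(2)] by (simp add: val_dom_def)
  moreover have "causality (sort_es \<E> T) \<subseteq> causality (sort_es \<E> S)"
    using assms(2) by auto
  ultimately show ?thesis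
    unfolding restr_eq_subtrace[OF t] by (intro \<T>_subtrace[OF t y] subtrace_in_traces[OF \<T>_traces[OF t] y])
qed

text \<open>The events of a directed set of traces fill up the events of its lub, and a finite set
  of events is already contained in one member.\<close>

lemma finite_compact:
  assumes b: "b \<in> \<T> S" and fin: "finite (fst b)"
  shows "b \<in> compacts (\<T> S) trace_le"
  unfolding compacts_def
proof (intro CollectI conjI allI impI)
  fix A s
  assume A: "directed_in (\<T> S) trace_le A" and lub: "lub_in (\<T> S) trace_le A s"
    and bs: "trace_le b s"
  have s: "s \<in> \<T> S" and As: "\<And>a. a \<in> A \<Longrightarrow> trace_le a s"
    using lub by (auto simp: lub_in_def)
  \<comment> \<open>The prefix of \<open>s\<close> on these events is an upper bound of
    \<open>A\<close>; leastness of \<open>s\<close> then gives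
    \<open>fst s \<subseteq> ?y\<close>.\<close>
  let ?y = "\<Union> (fst ` A)"
  have y: "trace_le (subtrace s ?y) s"
    unfolding trace_le_iff_subtrace
  proof (intro conjI allI impI)
    show "?y \<subseteq> fst s" using As trace_le_subset by blast
    show "p \<in> ?y" if pq: "(p, q) \<in> snd s" and q: "q \<in> ?y" for p q
    proof -
      obtain a where "a \<in> A" "q \<in> fst a" using q by blast
      then show ?thesis using trace_le_down_closed[OF As pq] by blast
    qed
  qed
  have "trace_le a (subtrace s ?y)" if "a \<in> A" for a
  proof -
    have a: "a = subtrace s (fst a)" by (rule trace_le_eq_subtrace[OF As[OF that]])
    then have "trace_le (subtrace s (fst a)) s" using As[OF that] by simp
    then have "trace_le (subtrace s (fst a)) (subtrace s ?y)"
      by (rule trace_le_subtrace_mono) (use that in blast)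
    then show ?thesis using a by simp
  qed
  then have "trace_le s (subtrace s ?y)"
    using lub down_subtrace_in_\<T>[OF s y] by (simp add: lub_in_def)
  then have "fst s \<subseteq> ?y" by (simp add: trace_le_def)
  then have "fst b \<subseteq> ?y" using trace_le_subset[OF bs] by blast
  moreover have "\<exists>a\<in>A. B \<subseteq> fst a" if "finite B" "B \<subseteq> ?y" for B
    using that
  proof (induction B rule: finite_induct)
    case empty
    then show ?case using A by (auto simp: directed_in_def)
  next
    case (insert p B)
    then obtain a a' where a: "a \<in> A" "B \<subseteq> fst a" "a' \<in> A" "p \<in> fst a'" by auto
    then obtain c where c: "c \<in> A" "trace_le a c" "trace_le a' c"
      using A unfolding directed_in_def by blast
    then have "fst a \<subseteq> fst c" "fst a' \<subseteq> fst c" by (simp_all add: trace_le_def)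
    then show ?case using a c(1) by blast
  qed
  ultimately have "\<exists>a\<in>A. fst b \<subseteq> fst a" using fin by blast
  then obtain a where a: "a \<in> A" "fst b \<subseteq> fst a" by blast
  \<comment> \<open>Both \<open>a\<close> and \<open>b\<close> are prefixes of \<open>s\<close>, so
    inclusion of their events is enough for \<open>trace_le b a\<close>.\<close>
  have "b = subtrace s (fst b)" "a = subtrace s (fst a)"
    by (rule trace_le_eq_subtrace[OF bs], rule trace_le_eq_subtrace[OF As[OF a(1)]])
  then have "trace_le b a" using trace_le_subtrace_mono[of s "fst b" "fst a"] a(2) bs by simp
  then show "\<exists>a\<in>A. trace_le b a" using a(1) by blast
qed (rule b)

text \<open>Both prefixes are finite, hence compact. Any trace between them is the subtrace of
  \<open>t\<close> on its own events, and only one event is available to be added.\<close>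

lemma past_covers:
  assumes t: "t \<in> \<T> S" and e: "e \<in> fst t"
  shows "covers_rel (\<T> S) trace_le t (subtrace t (strict_past t e)) (subtrace t (insert e (strict_past t e)))"
proof -
  let ?u = "strict_past t e" and ?v = "insert e (strict_past t e)"
  note tr = \<T>_traces[OF t]
  have u: "trace_le (subtrace t ?u) t" and v: "trace_le (subtrace t ?v) t"
    unfolding trace_le_iff_subtrace
    using strict_past_subset[OF tr, of e] strict_past_down_closed[OF tr, of _ _ e] e
    by (auto simp: strict_past_def)
  have "finite ?u"
    by (rule finite_subset[OF _ traces_finite_past[OF tr, of e]]) (auto simp: strict_past_def)
  then have "subtrace t ?u \<in> compacts_below (\<T> S) trace_le t" "subtrace t ?v \<in> compacts_below (\<T> S) trace_le t"
    unfolding compacts_below_def using finite_compact down_subtrace_in_\<T>[OF t] u v by auto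
  moreover have "covers (\<T> S) trace_le (subtrace t ?u) (subtrace t ?v)"
    unfolding covers_def
  proof (intro conjI)
    show "subtrace t ?u \<in> \<T> S" "subtrace t ?v \<in> \<T> S"
      using down_subtrace_in_\<T>[OF t] u v by blast+
    show "trace_le (subtrace t ?u) (subtrace t ?v)" by (rule trace_le_subtrace_mono[OF u]) blast
    have "e \<notin> ?u" by (simp add: strict_past_def)
    then show "subtrace t ?u \<noteq> subtrace t ?v" by (metis fst_subtrace insertI1)
    show "\<not> (\<exists>z\<in>\<T> S. trace_le (subtrace t ?u) z \<and> subtrace t ?u \<noteq> z \<and> trace_le z (subtrace t ?v) \<and> z \<noteq> subtrace t ?v)"
    proof
      assume "\<exists>z\<in>\<T> S. trace_le (subtrace t ?u) z \<and> subtrace t ?u \<noteq> z \<and> trace_le z (subtrace t ?v) \<and> z \<noteq> subtrace t ?v"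
      then obtain z where z: "trace_le (subtrace t ?u) z" "subtrace t ?u \<noteq> z" "trace_le z (subtrace t ?v)"
        "z \<noteq> subtrace t ?v" by blast
      have sub: "?u \<subseteq> fst z" "fst z \<subseteq> ?v" using z(1,3) by (simp_all add: trace_le_def)
      then have "z = subtrace t (fst z)"
        using trace_le_eq_subtrace[OF z(3)] subtrace_subtrace[OF sub(2)] by metis
      moreover have "fst z = ?u \<or> fst z = ?v" using sub by blast
      ultimately show False using z(2,4) by metis
    qed
  qed
  ultimately show ?thesis by (simp add: covers_rel_def)
qed

text \<open>If \<open>v\<close> covers \<open>u\<close> and \<open>e\<close> is an event of \<open>v\<close> outside \<open>u\<close>, then adding to \<open>u\<close> the strict
  past of \<open>e\<close> gives a trace between \<open>u\<close> and \<open>v\<close> without \<open>e\<close>, hence \<open>u\<close> itself.\<close>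

lemma covers_strict_past:
  assumes t: "t \<in> \<T> S" and "covers_rel (\<T> S) trace_le t u v" and e: "e \<in> fst v"
  shows "strict_past t e \<subseteq> fst u"
proof -
  note tr = \<T>_traces[OF t]
  have le: "trace_le u t" "trace_le v t" and cov: "covers (\<T> S) trace_le u v"
    using assms(2) by (auto simp: covers_rel_def compacts_below_def)
  have past_le: "strict_past t e \<subseteq> fst w" if "trace_le w t" "e \<in> fst w" for w
    using trace_le_down_closed[OF that(1) _ that(2)] unfolding strict_past_def by blast
  show ?thesis
  proof (cases "e \<in> fst u")
    case True
    then show ?thesis using past_le le(1) by blast
  next
    case False
    let ?z = "fst u \<union> strict_past t e"
    have u: "u = subtrace t (fst u)" and v: "v = subtrace t (fst v)"
      by (rule trace_le_eq_subtrace[OF le(1)], rule trace_le_eq_subtrace[OF le(2)])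
    have uv: "fst u \<subseteq> fst v" using cov by (auto simp: covers_def trace_le_def)
    have z: "trace_le (subtrace t ?z) t"
      unfolding trace_le_iff_subtrace
    proof (intro conjI allI impI)
      show "?z \<subseteq> fst t"
        using trace_le_subset[OF le(1)] strict_past_subset[OF tr, of e] by simp
      show "a \<in> ?z" if "(a, b) \<in> snd t" "b \<in> ?z" for a b
        using that(2) trace_le_down_closed[OF le(1) that(1)] strict_past_down_closed[OF tr that(1), of e]
        by blast
    qed
    have between: "w = u" if "w \<in> \<T> S" "trace_le u w" "trace_le w v" "w \<noteq> v" for w
      using cov that unfolding covers_def by metis
    have "trace_le u (subtrace t ?z)" using trace_le_subtrace_mono[of t "fst u" ?z] le(1) u by auto
    moreover have "trace_le (subtrace t ?z) v"
      using trace_le_subtrace_mono[OF z, of "fst v"] uv past_le[OF le(2) e] v by auto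
    moreover have "e \<notin> ?z" using False by (simp add: strict_past_def)
    then have "subtrace t ?z \<noteq> v" using e by auto
    ultimately have "subtrace t ?z = u"
      by (rule between[OF down_subtrace_in_\<T>[OF t z]])
    then have "?z = fst u" by (simp add: subtrace_def prod_eq_iff)
    then show ?thesis by blast
  qed
qed

text \<open>Turns the condition on covering pairs into one on single events. Forward, it is applied
  to the cover that adds \<open>e\<close> to its strict past; backward, the lower trace of any cover
  contains the strict pasts of the events of the upper one, and \<open>f\<close> is
  monotone.\<close>

lemma covers_condition_iff:
  assumes t: "t \<in> \<T> S" and "In \<subseteq> S" "Out \<subseteq> S"
    and f: "f \<in> continuous_maps (val_dom \<E> In) (\<subseteq>) (val_dom \<E> Out) (\<subseteq>)"
  shows "(\<forall>u v. covers_rel (\<T> S) trace_le t u v \<longrightarrow> restr_val \<E> Out v \<subseteq> f (restr_val \<E> In u)) \<longleftrightarrow>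
    (\<forall>e\<in>fst t. fst e \<in> Out \<longrightarrow> e \<in> f (proj \<E> In (strict_past t e)))" (is "?L \<longleftrightarrow> ?R")
proof
  assume L: ?L
  show ?R
  proof (intro ballI impI)
    fix e assume e: "e \<in> fst t" "fst e \<in> Out"
    have "e \<in> proj \<E> Out (insert e (strict_past t e))"
      using e mem_proj[OF fst_val_dom[OF t]] by (auto simp: proj_def)
    then show "e \<in> f (proj \<E> In (strict_past t e))"
      using L past_covers[OF t e(1)] by (fastforce simp: restr_val_eq)
  qed
next
  assume R: ?R
  show ?L
  proof (intro allI impI subsetI)
    fix u v e
    assume cov: "covers_rel (\<T> S) trace_le t u v" and e: "e \<in> restr_val \<E> Out v"
    have u: "u \<in> \<T> S" and v: "v \<in> \<T> S" "trace_le v t"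
      using cov by (auto simp: covers_rel_def covers_def compacts_below_def)
    have ev: "e \<in> fst v" "fst e \<in> Out"
      using e mem_proj[OF fst_val_dom[OF v(1)]] by (auto simp: restr_val_eq)
    then have "e \<in> f (proj \<E> In (strict_past t e))"
      using R trace_le_subset[OF v(2)] by blast
    moreover have "f (proj \<E> In (strict_past t e)) \<subseteq> f (proj \<E> In (fst u))"
      using covers_strict_past[OF t cov ev(1)]
      by (intro continuous_maps_mono[OF f] proj_mono
          proj_val_dom[OF strict_past_val_dom[OF t] assms(2)] proj_val_dom[OF fst_val_dom[OF u] assms(2)])
    ultimately show "e \<in> f (restr_val \<E> In u)" by (auto simp: restr_val_eq)
  qed
qed

text \<open>Expresses membership of the restricted trace through \<open>t\<close> itself.
  Restriction merely intersects strict pasts with the events of the node, which include all its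
  inputs, so the projection to \<open>In\<close> sees no difference.\<close>

lemma restr_computes_iff:
  assumes t: "t \<in> \<T> S" and comp: "computes \<E> \<T> p In Out F" and sub: "fst p \<subseteq> S"
  shows "restr \<E> (fst p) t \<in> snd p \<longleftrightarrow>
    (\<exists>f\<in>F. proj \<E> Out (fst t) = f (proj \<E> In (fst t)) \<and>
      (\<forall>e\<in>fst t. fst e \<in> Out \<longrightarrow> e \<in> f (proj \<E> In (strict_past t e))))"
proof -
  let ?t = "restr \<E> (fst p) t"
  have p: "fst p = In \<union> Out" and F: "F \<subseteq> continuous_maps (val_dom \<E> In) (\<subseteq>) (val_dom \<E> Out) (\<subseteq>)"
    using comp by (auto simp: computes_def)
  have r: "?t \<in> \<T> (fst p)" by (rule restr_in_\<T>[OF t sub])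
  have fst_r: "fst ?t = proj \<E> (fst p) (fst t)" using restr_eq_subtrace[OF t] by simp
  have "proj \<E> Out (proj \<E> (fst p) x) = proj \<E> Out x" "proj \<E> In (proj \<E> (fst p) x) = proj \<E> In x" for x
    unfolding p by (auto simp: proj_def)
  then have pr: "restr_val \<E> Out ?t = proj \<E> Out (fst t)" "restr_val \<E> In ?t = proj \<E> In (fst t)"
    by (simp_all add: restr_val_eq fst_r)
  have past: "proj \<E> In (strict_past ?t e) = proj \<E> In (strict_past t e)" if "e \<in> fst ?t" for e
  proof -
    have "e \<in> proj \<E> (fst p) (fst t)" using that fst_r by simp
    then have "strict_past ?t e = strict_past t e \<inter> proj \<E> (fst p) (fst t)"
      unfolding restr_eq_subtrace[OF t] by (rule strict_past_subtrace)
    moreover have "strict_past t e \<subseteq> fst t" by (rule strict_past_subset[OF \<T>_traces[OF t]])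
    ultimately show ?thesis unfolding p by (auto simp: proj_def)
  qed
  have io: "In \<subseteq> fst p" "Out \<subseteq> fst p" using p by auto
  have mem: "e \<in> fst ?t \<longleftrightarrow> e \<in> fst t" if "fst e \<in> Out" for e
    using that io(2) unfolding fst_r mem_proj[OF fst_val_dom[OF t]] by auto
  have cond: "(\<forall>u v. covers_rel (\<T> (fst p)) trace_le ?t u v \<longrightarrow> restr_val \<E> Out v \<subseteq> f (restr_val \<E> In u)) \<longleftrightarrow>
      (\<forall>e\<in>fst t. fst e \<in> Out \<longrightarrow> e \<in> f (proj \<E> In (strict_past t e)))" if "f \<in> F" for f
    unfolding covers_condition_iff[OF r io subsetD[OF F that]] using mem past by metis
  have "?t \<in> snd p \<longleftrightarrow> (\<exists>f\<in>F. restr_val \<E> Out ?t = f (restr_val \<E> In ?t) \<and>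
      (\<forall>u v. covers_rel (\<T> (fst p)) trace_le ?t u v \<longrightarrow> restr_val \<E> Out v \<subseteq> f (restr_val \<E> In u)))"
    using comp r unfolding computes_def by blast
  also have "\<dots> \<longleftrightarrow> (\<exists>f\<in>F. proj \<E> Out (fst t) = f (proj \<E> In (fst t)) \<and>
      (\<forall>e\<in>fst t. fst e \<in> Out \<longrightarrow> e \<in> f (proj \<E> In (strict_past t e))))"
    unfolding pr by (intro bex_cong conj_cong refl cond)
  finally show ?thesis .
qed

end


section \<open>Networks\<close>

locale functional_network = trace_model \<E> \<T>
  for \<E> :: "'c \<Rightarrow> 'e event_structure" and \<T> :: "'c set \<Rightarrow> ('c \<times> 'e) trace set" +
  fixes J :: "'j set" and N :: "'j \<Rightarrow> ('c, 'e) process" and In Out :: "'j \<Rightarrow> 'c set"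
    and F :: "'j \<Rightarrow> ('c, 'e) val_map set" and S :: "'c set" and P :: "('c \<times> 'e) trace set"
  assumes network: "nd_functional_network \<E> \<T> J N In Out F"
    and composition: "network_composition \<E> \<T> J N = (S, P)"
begin

lemma S_eq: "S = (\<Union>j\<in>J. fst (N j))"
  and P_eq: "P = {t \<in> \<T> S. \<forall>j\<in>J. restr \<E> (fst (N j)) t \<in> snd (N j)}"
  using composition by (auto simp: network_composition_def)

lemma network_computes: "j \<in> J \<Longrightarrow> computes \<E> \<T> (N j) (In j) (Out j) (F j)"
  using network by (auto simp: nd_functional_network_def)

lemma ex1_out: "\<alpha> \<in> S \<Longrightarrow> \<exists>!j. j \<in> J \<and> \<alpha> \<in> Out j"
  using network composition by (auto simp: nd_functional_network_def)

lemma ex_out: "\<alpha> \<in> S \<Longrightarrow> \<exists>j\<in>J. \<alpha> \<in> Out j"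
  using ex1_out by blast

lemma node_subset:
  assumes j: "j \<in> J"
  shows "fst (N j) \<subseteq> S" "In j \<subseteq> S" "Out j \<subseteq> S"
proof -
  show "fst (N j) \<subseteq> S" using j S_eq by blast
  moreover have "fst (N j) = In j \<union> Out j"
    using network_computes[OF j] by (simp add: computes_def)
  ultimately show "In j \<subseteq> S" "Out j \<subseteq> S" by auto
qed

lemma node_continuous:
  "j \<in> J \<Longrightarrow> g \<in> F j \<Longrightarrow> g \<in> continuous_maps (val_dom \<E> (In j)) (\<subseteq>) (val_dom \<E> (Out j)) (\<subseteq>)"
  using network_computes unfolding computes_def by blast

section \<open>The network map for a fixed choice of node functions\<close>

context
  fixes f assumes f: "f \<in> (\<Pi>\<^sub>E j\<in>J. F j)"
begin

abbreviation "G \<equiv> network_map \<E> J S In Out f"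

lemma f_continuous:
  "j \<in> J \<Longrightarrow> f j \<in> continuous_maps (val_dom \<E> (In j)) (\<subseteq>) (val_dom \<E> (Out j)) (\<subseteq>)"
  using f node_continuous by blast

lemma f_val_dom:
  "j \<in> J \<Longrightarrow> x \<in> val_dom \<E> S \<Longrightarrow> f j (proj \<E> (In j) x) \<in> val_dom \<E> (Out j)"
  using f_continuous proj_val_dom node_subset(2) unfolding continuous_maps_def by blast

text \<open>In the union defining the map, only the term of channel \<open>\<alpha>\<close> contains
  events on \<open>\<alpha>\<close>, and uniqueness of the producing node makes \<open>THE\<close>
  return \<open>j\<close>.\<close>

lemma mem_network_map:
  assumes x: "x \<in> val_dom \<E> S" and j: "j \<in> J" "\<alpha> \<in> Out j"
  shows "(\<alpha>, e) \<in> G x \<longleftrightarrow> (\<alpha>, e) \<in> f j (proj \<E> (In j) x)"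
proof -
  have \<alpha>: "\<alpha> \<in> S" using node_subset(3) j by blast
  have the: "(THE i. i \<in> J \<and> \<beta> \<in> Out i) = i" if "i \<in> J" "\<beta> \<in> Out i" for \<beta> i
    using ex1_out[of \<beta>] node_subset(3)[OF that(1)] that by (intro the1_equality) auto
  have *: "p \<in> proj \<E> {\<beta>} (f i (proj \<E> (In i) x)) \<longleftrightarrow> p \<in> f i (proj \<E> (In i) x) \<and> fst p = \<beta>"
    if "i \<in> J" for \<beta> i p
    using mem_proj[OF f_val_dom[OF that x]] by auto
  have "p \<in> G x \<longleftrightarrow> p \<in> proj \<E> {\<alpha>} (f j (proj \<E> (In j) x))" if "fst p = \<alpha>" for p
  proof -
    have "p \<in> G x \<longleftrightarrow> (\<exists>\<beta>\<in>S. p \<in> proj \<E> {\<beta>} (f (THE i. i \<in> J \<and> \<beta> \<in> Out i) (proj \<E> (In (THE i. i \<in> J \<and> \<beta> \<in> Out i)) x)))"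
      by (simp add: network_map_def Let_def)
    also have "\<dots> \<longleftrightarrow> p \<in> proj \<E> {\<alpha>} (f (THE i. i \<in> J \<and> \<alpha> \<in> Out i) (proj \<E> (In (THE i. i \<in> J \<and> \<alpha> \<in> Out i)) x))"
      using \<alpha> that by (auto simp: proj_def)
    finally show ?thesis using the[OF j] by simp
  qed
  then show ?thesis using *[OF j(1)] by simp
qed

lemma fst_network_map: "x \<in> val_dom \<E> S \<Longrightarrow> p \<in> G x \<Longrightarrow> fst p \<in> S"
  by (auto simp: network_map_def proj_def Let_def)

lemma network_map_val_dom:
  assumes x: "x \<in> val_dom \<E> S"
  shows "G x \<in> val_dom \<E> S"
  unfolding val_dom_iff
proof (intro conjI ballI)
  show "fst ` G x \<subseteq> S" using fst_network_map[OF x] by blast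
  fix \<alpha> assume "\<alpha> \<in> S"
  then obtain j where j: "j \<in> J" "\<alpha> \<in> Out j" using ex1_out by blast
  then show "{e. (\<alpha>, e) \<in> G x} \<in> configurations (\<E> \<alpha>)"
    using f_val_dom[OF j(1) x] mem_network_map[OF x j] by (simp add: val_dom_iff)
qed

lemma finitary_network_map: "finitary_map (sort_es \<E> S) G"
proof -
  interpret X: finitary_es "sort_es \<E> T" for T by (rule finitary_sort_es[OF es])
  show ?thesis
  proof (unfold_locales, fold val_dom_def)
    show "G x \<in> val_dom \<E> S" if "x \<in> val_dom \<E> S" for x by (rule network_map_val_dom[OF that])
    show "G x \<subseteq> G y" if x: "x \<in> val_dom \<E> S" and y: "y \<in> val_dom \<E> S" and "x \<subseteq> y" for x y
    proof
      fix p assume p: "p \<in> G x"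
      obtain \<alpha> e where pe: "p = (\<alpha>, e)" by force
      then obtain j where j: "j \<in> J" "\<alpha> \<in> Out j" using ex_out[OF fst_network_map[OF x p]] by auto
      have "f j (proj \<E> (In j) x) \<subseteq> f j (proj \<E> (In j) y)"
        using \<open>x \<subseteq> y\<close> by (intro continuous_maps_mono[OF f_continuous[OF j(1)]] proj_mono
            proj_val_dom[OF x] proj_val_dom[OF y] node_subset(2)[OF j(1)])
      then show "p \<in> G y"
        using p mem_network_map[OF x j] mem_network_map[OF y j] unfolding pe by blast
    qed
    show "\<exists>y0. finite y0 \<and> y0 \<subseteq> y \<and> y0 \<in> val_dom \<E> S \<and> p \<in> G y0"
      if y: "y \<in> val_dom \<E> S" and p: "p \<in> G y" for y p
    proof -
      obtain \<alpha> e where pe: "p = (\<alpha>, e)" by force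
      then obtain j where j: "j \<in> J" "\<alpha> \<in> Out j" using ex_out[OF fst_network_map[OF y p]] by auto
      have "(\<alpha>, e) \<in> f j (proj \<E> (In j) y)" using p mem_network_map[OF y j] pe by blast
      then obtain y0 where y0: "finite y0" "y0 \<subseteq> proj \<E> (In j) y" "y0 \<in> val_dom \<E> (In j)"
        "(\<alpha>, e) \<in> f j y0"
        using X.continuous_maps_finite_support[OF f_continuous[OF j(1), unfolded val_dom_def]]
          proj_val_dom[OF y node_subset(2)[OF j(1)]] unfolding val_dom_def by metis
      \<comment> \<open>An event on \<open>\<alpha>\<close> depends on node \<open>j\<close> alone,
        so the finite support found for \<open>f j\<close> supports it for \<open>G\<close> too,
        even when the network is infinite.\<close>
      have y0S: "y0 \<in> val_dom \<E> S"
        by (rule val_dom_superset[OF es y0(3) node_subset(2)[OF j(1)]])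
      have "proj \<E> (In j) y0 = y0"
        using proj_eq[OF y0(3)] y0(3) by (auto simp: val_dom_iff)
      then have "p \<in> G y0" using mem_network_map[OF y0S j] y0(4) pe by simp
      moreover have "y0 \<subseteq> y" using y0(2) by (auto simp: proj_def)
      ultimately show ?thesis using y0(1) y0S by blast
    qed
  qed
qed

text \<open>Every channel of \<open>S\<close> is an output of some node, so the conditions of the
  individual nodes, taken together, speak about all channels.\<close>

lemma node_conditions_iff:
  assumes t: "t \<in> \<T> S"
  shows "(\<forall>j\<in>J. proj \<E> (Out j) (fst t) = f j (proj \<E> (In j) (fst t)) \<and>
      (\<forall>e\<in>fst t. fst e \<in> Out j \<longrightarrow> e \<in> f j (proj \<E> (In j) (strict_past t e)))) \<longleftrightarrow>
    G (fst t) = fst t \<and> (\<forall>e\<in>fst t. e \<in> G (strict_past t e))" (is "?L \<longleftrightarrow> ?R")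
proof -
  note x = fst_val_dom[OF t]
  have S: "fst p \<in> S" if "p \<in> fst t" for p using x that by (auto simp: val_dom_iff)
  have node: "proj \<E> (Out j) (fst t) = f j (proj \<E> (In j) (fst t)) \<longleftrightarrow>
    (\<forall>p. fst p \<in> Out j \<longrightarrow> (p \<in> G (fst t) \<longleftrightarrow> p \<in> fst t))" if j: "j \<in> J" for j
  proof -
    have "fst p \<in> Out j" if "p \<in> f j (proj \<E> (In j) (fst t))" for p
      using f_val_dom[OF j x] that by (auto simp: val_dom_iff)
    then have "proj \<E> (Out j) (fst t) = f j (proj \<E> (In j) (fst t)) \<longleftrightarrow>
      (\<forall>p. fst p \<in> Out j \<longrightarrow> (p \<in> f j (proj \<E> (In j) (fst t)) \<longleftrightarrow> p \<in> fst t))"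
      unfolding set_eq_iff mem_proj[OF x] by blast
    also have "\<dots> \<longleftrightarrow> (\<forall>p. fst p \<in> Out j \<longrightarrow> (p \<in> G (fst t) \<longleftrightarrow> p \<in> fst t))"
      using mem_network_map[OF x j] by auto
    finally show ?thesis .
  qed
  have "(\<forall>j\<in>J. proj \<E> (Out j) (fst t) = f j (proj \<E> (In j) (fst t))) \<longleftrightarrow> G (fst t) = fst t"
  proof -
    have "(\<forall>j\<in>J. \<forall>p. fst p \<in> Out j \<longrightarrow> (p \<in> G (fst t) \<longleftrightarrow> p \<in> fst t)) \<longleftrightarrow> G (fst t) = fst t"
      unfolding set_eq_iff using ex_out S fst_network_map[OF x] by blast
    then show ?thesis using node by simp
  qed
  moreover have "e \<in> f j (proj \<E> (In j) (strict_past t e)) \<longleftrightarrow> e \<in> G (strict_past t e)"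
    if "j \<in> J" "fst e \<in> Out j" for e j
    using mem_network_map[OF strict_past_val_dom[OF t] that, of "snd e" e] by simp
  then have "(\<forall>j\<in>J. \<forall>e\<in>fst t. fst e \<in> Out j \<longrightarrow> e \<in> f j (proj \<E> (In j) (strict_past t e))) \<longleftrightarrow>
    (\<forall>e\<in>fst t. e \<in> G (strict_past t e))"
    using ex_out S by blast
  ultimately show ?thesis by blast
qed

end

text \<open>Each node selects its function independently of the others, so the axiom of choice
  assembles the local witnesses into one \<open>f\<close>.\<close>

lemma composition_iff:
  assumes t: "t \<in> \<T> S"
  shows "t \<in> P \<longleftrightarrow> (\<exists>f\<in>(\<Pi>\<^sub>E j\<in>J. F j). G f (fst t) = fst t \<and> (\<forall>e\<in>fst t. e \<in> G f (strict_past t e)))"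
proof -
  define C where "C j g \<longleftrightarrow> proj \<E> (Out j) (fst t) = g (proj \<E> (In j) (fst t)) \<and>
      (\<forall>e\<in>fst t. fst e \<in> Out j \<longrightarrow> e \<in> g (proj \<E> (In j) (strict_past t e)))" for j g
  have "restr \<E> (fst (N j)) t \<in> snd (N j) \<longleftrightarrow> (\<exists>g\<in>F j. C j g)" if "j \<in> J" for j
    unfolding C_def by (rule restr_computes_iff[OF t network_computes[OF that] node_subset(1)[OF that]])
  then have "t \<in> P \<longleftrightarrow> (\<forall>j\<in>J. \<exists>g\<in>F j. C j g)"
    using t by (simp add: P_eq)
  also have "\<dots> \<longleftrightarrow> (\<exists>f\<in>(\<Pi>\<^sub>E j\<in>J. F j). \<forall>j\<in>J. C j (f j))"
  proof
    assume "\<forall>j\<in>J. \<exists>g\<in>F j. C j g"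
    then have "\<forall>j\<in>J. \<exists>g. g \<in> F j \<and> C j g" by blast
    then obtain f where f: "\<forall>j\<in>J. f j \<in> F j \<and> C j (f j)" by (auto dest!: bchoice)
    \<comment> \<open>Elements of the dependent product are undefined outside \<open>J\<close>,
      hence the \<open>restrict\<close>.\<close>
    then have "restrict f J \<in> (\<Pi>\<^sub>E j\<in>J. F j)" "\<forall>j\<in>J. C j (restrict f J j)" by auto
    then show "\<exists>f\<in>(\<Pi>\<^sub>E j\<in>J. F j). \<forall>j\<in>J. C j (f j)" by blast
  qed blast
  also have "\<dots> \<longleftrightarrow> (\<exists>f\<in>(\<Pi>\<^sub>E j\<in>J. F j). G f (fst t) = fst t \<and> (\<forall>e\<in>fst t. e \<in> G f (strict_past t e)))"
    unfolding C_def by (rule bex_cong[OF refl node_conditions_iff[OF _ t]])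
  finally show ?thesis .
qed

text \<open>The premise \<open>ext\<close> isolates what separates the two models: the generated
  partial order must be enlarged, on the same events, to an order that the model admits.\<close>

lemma kahn_principle:
  assumes ext: "\<And>t. t \<in> traces (sort_es \<E> S) \<Longrightarrow> \<exists>t'\<in>\<T> S. fst t' = fst t \<and> snd t \<subseteq> snd t'"
  shows "eval_trace ` P = {kleene_lfp (G f) | f. f \<in> (\<Pi>\<^sub>E j\<in>J. F j)}"
proof (intro set_eqI iffI)
  fix x assume "x \<in> eval_trace ` P"
  then obtain t where t: "t \<in> P" "x = fst t" by (auto simp: eval_trace_def)
  have tT: "t \<in> \<T> S" using t(1) P_eq by blast
  then obtain f where f: "f \<in> (\<Pi>\<^sub>E j\<in>J. F j)" "G f (fst t) = fst t"
    "\<forall>e\<in>fst t. e \<in> G f (strict_past t e)"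
    using t(1) composition_iff by blast
  interpret finitary_map "sort_es \<E> S" "G f" by (rule finitary_network_map[OF f(1)])
  have "x = kleene_lfp (G f)"
    using generated_trace_lfp[OF \<T>_traces[OF tT] f(2)] f(3) t(2)
    by (simp add: kleene_lfp_def lfp_G_def iter_def)
  then show "x \<in> {kleene_lfp (G f) | f. f \<in> (\<Pi>\<^sub>E j\<in>J. F j)}" using f(1) by blast
next
  fix x assume "x \<in> {kleene_lfp (G f) | f. f \<in> (\<Pi>\<^sub>E j\<in>J. F j)}"
  then obtain f where f: "f \<in> (\<Pi>\<^sub>E j\<in>J. F j)" and x: "x = kleene_lfp (G f)" by blast
  interpret finitary_map "sort_es \<E> S" "G f" by (rule finitary_network_map[OF f])
  have x: "x = lfp_G" using x by (simp add: kleene_lfp_def lfp_G_def iter_def)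
  obtain t where t: "t \<in> traces (sort_es \<E> S)" "fst t = lfp_G"
    "\<And>e. e \<in> lfp_G \<Longrightarrow> e \<in> G f (strict_past t e)"
    using ex_generated_trace by blast
  obtain t' where t': "t' \<in> \<T> S" "fst t' = lfp_G" "snd t \<subseteq> snd t'" using ext[OF t(1)] t(2) by auto
  have "e \<in> G f (strict_past t' e)" if "e \<in> lfp_G" for e
  proof -
    \<comment> \<open>Enlarging the order enlarges strict pasts, and \<open>G f\<close> is monotone,
      so every event is still generated from its strict past.\<close>
    have "strict_past t e \<subseteq> strict_past t' e" using t'(3) by (auto simp: strict_past_def)
    then have "G f (strict_past t e) \<subseteq> G f (strict_past t' e)"
      by (rule G_mono[OF strict_past_configuration[OF t(1)]
            strict_past_configuration[OF \<T>_traces[OF t'(1)]]])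
    then show ?thesis using t(3)[OF that] by blast
  qed
  then have "t' \<in> P" using composition_iff[OF t'(1)] f G_lfp t'(2) by auto
  then show "x \<in> eval_trace ` P" using x t'(2) by (auto simp: eval_trace_def)
qed

end

section \<open>The partially ordered and the linear model\<close>

lemma trace_model_P:
  assumes "\<And>\<alpha>. prime_event_structure (\<E> \<alpha>)"
  shows "trace_model \<E> (model_P \<E>)"
  using assms by unfold_locales (auto simp: model_P_def)

lemma trace_model_L:
  assumes "\<And>\<alpha>. prime_event_structure (\<E> \<alpha>)"
  shows "trace_model \<E> (model_L \<E>)"
proof
  show "t \<in> traces (sort_es \<E> S)" if "t \<in> model_L \<E> S" for t S
    using that by (auto simp: model_L_def linear_traces_def)
  show "subtrace t x \<in> model_L \<E> S'"
    if t: "t \<in> model_L \<E> S" and x: "x \<subseteq> fst t" and c: "subtrace t x \<in> traces (sort_es \<E> S')" for t x S S'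
  proof -
    have "total_on (fst t) (snd t)"
      using t by (auto simp: model_L_def linear_traces_def linear_order_on_def)
    then have "total_on x (snd t \<inter> x \<times> x)" using x unfolding total_on_def by blast
    then show ?thesis
      using c by (auto simp: model_L_def linear_traces_def linear_order_on_def traces_def subtrace_def)
  qed
qed (rule assms)

text \<open>The linear half has the premise that \<open>sort_es \<E> S\<close> is prime, for the
  sake of countability: a linear order with finite pasts exists only on a countable set, while an
  uncountable sort may have uncountably many events.\<close>

theorem theorem3:
  fixes \<E> :: "'c \<Rightarrow> 'e event_structure"
  assumes "\<And>\<alpha>. prime_event_structure (\<E> \<alpha>)"
  shows
    "(\<forall>(J :: 'j set) N In Out F S P.
        nd_functional_network \<E> (model_P \<E>) J N In Out F \<longrightarrow>
        network_composition \<E> (model_P \<E>) J N = (S, P) \<longrightarrow>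
        eval_trace ` P = {kleene_lfp (network_map \<E> J S In Out f) | f. f \<in> (\<Pi>\<^sub>E j\<in>J. F j)}) \<and>
     (\<forall>(J :: 'j set) N In Out F S P.
        nd_functional_network \<E> (model_L \<E>) J N In Out F \<longrightarrow>
        network_composition \<E> (model_L \<E>) J N = (S, P) \<longrightarrow>
        prime_event_structure (sort_es \<E> S) \<longrightarrow>
        eval_trace ` P = {kleene_lfp (network_map \<E> J S In Out f) | f. f \<in> (\<Pi>\<^sub>E j\<in>J. F j)})"
proof (intro conjI allI impI)
  fix J :: "'j set" and N In Out F S P
  assume "nd_functional_network \<E> (model_P \<E>) J N In Out F"
    and "network_composition \<E> (model_P \<E>) J N = (S, P)"
  then interpret functional_network \<E> "model_P \<E>" J N In Out F S P
    by (intro functional_network.intro functional_network_axioms.intro trace_model_P assms)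
  show "eval_trace ` P = {kleene_lfp (network_map \<E> J S In Out f) | f. f \<in> (\<Pi>\<^sub>E j\<in>J. F j)}"
    \<comment> \<open>A partially ordered trace serves as its own extension.\<close>
    by (rule kahn_principle) (auto simp: model_P_def)
next
  fix J :: "'j set" and N In Out F S P
  assume "nd_functional_network \<E> (model_L \<E>) J N In Out F"
    and "network_composition \<E> (model_L \<E>) J N = (S, P)"
    and S: "prime_event_structure (sort_es \<E> S)"
  then interpret functional_network \<E> "model_L \<E>" J N In Out F S P
    by (intro functional_network.intro functional_network_axioms.intro trace_model_L assms)
  show "eval_trace ` P = {kleene_lfp (network_map \<E> J S In Out f) | f. f \<in> (\<Pi>\<^sub>E j\<in>J. F j)}"
  proof (rule kahn_principle)
    fix t assume t: "t \<in> traces (sort_es \<E> S)"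
    then have "fst t \<subseteq> events (sort_es \<E> S)"
      using traces_configurations[OF t] by (simp add: configurations_def)
    then have "countable (fst t)"
      using S by (auto simp: prime_event_structure_def intro: countable_subset)
    then show "\<exists>t'\<in>model_L \<E> S. fst t' = fst t \<and> snd t \<subseteq> snd t'"
      using ex_linear_extension[OF t] unfolding model_L_def by metis
  qed
qed

end
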